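(* Each of the following holds. (a) Every $5$-edge-connected essentially $23$-edge-connected graph is $\mathcal{M}_3$-extendable at each of its vertices of degree $5$. (b) Every $5$-edge-connected essentially $23$-edge-connected graph is $\langle\mathbb{Z}_3\rangle$-extendable at each of its vertices of degree $5$.
   Context: Graphs are finite, have no loops, and may have multiple edges. An edge cut $X=[S,V(G)-S]$ of a connected graph $G$ (the set of edges with exactly one end in $S$) is essential if at least two components of $G-X$ are nontrivial (have more than one vertex). A graph is essentially $k$-edge-connected if it has no essential edge cut with fewer than $k$ edges. For an orientation $D$, $d_D^+(v)$ and $d_D^-(v)$ denote the out-degree and in-degree of $v$. $E_G(z_0)$ is the set of edges of $G$ incident with $z_0$; a pre-orientation $D_{z_0}$ of $E_G(z_0)$ is an orientation of just these edges. A zero-sum function of $G$ is a map $\beta: V(G)\to\mathbb{Z}_3$ with $\sum_{v\in V(G)}\beta(v)=0$ in $\mathbb{Z}_3$; a $\beta$-orientation of $G$ is an orientation $D$ of $G$ with $d_D^+(v)-d_D^-(v)=\beta(v)$ in $\mathbb{Z}_3$ for every $v\in V(G)$; a mod $3$-orientation is a $\beta$-orientation with $\beta$ identically $0$. $G$ is $\mathcal{M}_3$-extendable at $z_0$ if every pre-orientation $D_{z_0}$ of $E_G(z_0)$ with $d_{D_{z_0}}^+(z_0)\equiv d_{D_{z_0}}^-(z_0)\pmod 3$ can be extended to a mod $3$-orientation of $G$. $G$ is $\langle\mathbb{Z}_3\rangle$-extendable at $z_0$ if for every zero-sum function $\beta$ of $G$ and every pre-orientation $D_{z_0}$ of $E_G(z_0)$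 with $d_{D_{z_0}}^+(z_0)-d_{D_{z_0}}^-(z_0)\equiv\beta(z_0)\pmod 3$, $D_{z_0}$ can be extended to a $\beta$-orientation of $G$. *)

theory Defs
  imports
    "Graph_Theory.Digraph"
    "HOL-Library.Numeral_Type"
    "HOL-Number_Theory.Cong"
begin

text \<open>Finite loopless multigraphs: edges have an identity of their own, and parallel edges are
  distinct edges with the same pair of ends.\<close>

record ('v, 'e) pre_multigraph =
  vertices :: "'v set"
  edges :: "'e set"
  ends :: "'e \<Rightarrow> 'v set"

locale multigraph =
  fixes G :: "('v, 'e) pre_multigraph"
  assumes finite_vertices: "finite (vertices G)"
    and finite_edges: "finite (edges G)"
    and ends_in_vertices: "e \<in> edges G \<Longrightarrow> ends G e \<subseteq> vertices G"
    and two_ends: "e \<in> edges G \<Longrightarrow> card (ends G e) = 2"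

definition incident_edges :: "('v, 'e) pre_multigraph \<Rightarrow> 'v \<Rightarrow> 'e set" where
  "incident_edges G v = {e \<in> edges G. v \<in> ends G e}"

definition degree :: "('v, 'e) pre_multigraph \<Rightarrow> 'v \<Rightarrow> nat" where
  "degree G v = card (incident_edges G v)"

definition spanning_subgraph :: "('v, 'e) pre_multigraph \<Rightarrow> 'e set \<Rightarrow> ('v, 'e) pre_multigraph" where
  "spanning_subgraph G F = G\<lparr>edges := F\<rparr>"

definition delete_edges :: "('v, 'e) pre_multigraph \<Rightarrow> 'e set \<Rightarrow> ('v, 'e) pre_multigraph" where
  "delete_edges G X = spanning_subgraph G (edges G - X)"

definition adjacency :: "('v, 'e) pre_multigraph \<Rightarrow> 'v rel" where
  "adjacency G = {(u, v). \<exists>e \<in> edges G. ends G e = {u, v}}"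

definition connectedness :: "('v, 'e) pre_multigraph \<Rightarrow> 'v rel" where
  "connectedness G = {(u, v). u \<in> vertices G \<and> v \<in> vertices G \<and> (u, v) \<in> (adjacency G)\<^sup>*}"

text \<open>A component is represented by its vertex set.\<close>

definition components :: "('v, 'e) pre_multigraph \<Rightarrow> 'v set set" where
  "components G = vertices G // connectedness G"

definition connected_graph :: "('v, 'e) pre_multigraph \<Rightarrow> bool" where
  "connected_graph G \<longleftrightarrow>
     vertices G \<noteq> {} \<and> (\<forall>u \<in> vertices G. \<forall>v \<in> vertices G. (u, v) \<in> connectedness G)"

definition k_edge_connected :: "nat \<Rightarrow> ('v, 'e) pre_multigraph \<Rightarrow> bool" where
  "k_edge_connected k G \<longleftrightarrow>
     connected_graph G \<and>
     (\<forall>X \<subseteq> edges G. card X < k \<longrightarrow> connected_graph (delete_edges G X))"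

definition boundary :: "('v, 'e) pre_multigraph \<Rightarrow> 'v set \<Rightarrow> 'e set" where
  "boundary G S = {e \<in> edges G. card (ends G e \<inter> S) = 1}"

definition edge_cut :: "('v, 'e) pre_multigraph \<Rightarrow> 'e set \<Rightarrow> bool" where
  "edge_cut G X \<longleftrightarrow> (\<exists>S. S \<noteq> {} \<and> S \<subset> vertices G \<and> X = boundary G S)"

definition essential_edge_cut :: "('v, 'e) pre_multigraph \<Rightarrow> 'e set \<Rightarrow> bool" where
  "essential_edge_cut G X \<longleftrightarrow>
     edge_cut G X \<and>
     (\<exists>C \<in> components (delete_edges G X). \<exists>C' \<in> components (delete_edges G X).
        C \<noteq> C' \<and> card C > 1 \<and> card C' > 1)"

definition essentially_k_edge_connected :: "nat \<Rightarrow> ('v, 'e) pre_multigraph \<Rightarrow> bool" where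
  "essentially_k_edge_connected k G \<longleftrightarrow>
     connected_graph G \<and> \<not> (\<exists>X. essential_edge_cut G X \<and> card X < k)"

text \<open>An orientation is a digraph on the same vertices whose arcs are the edges, each running
  from one of its ends to the other. The values of \<^const>\<open>tail\<close> and \<^const>\<open>head\<close> outside the
  arc set carry no information.\<close>

definition orientation_of :: "('v, 'e) pre_multigraph \<Rightarrow> ('v, 'e) pre_digraph \<Rightarrow> bool" where
  "orientation_of G D \<longleftrightarrow>
     verts D = vertices G \<and> arcs D = edges G \<and>
     (\<forall>e \<in> edges G. {tail D e, head D e} = ends G e)"

definition pre_orientation_at ::
  "('v, 'e) pre_multigraph \<Rightarrow> 'v \<Rightarrow> ('v, 'e) pre_digraph \<Rightarrow> bool" where
  "pre_orientation_at G z D \<longleftrightarrow> orientation_of (spanning_subgraph G (incident_edges G z)) D"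

text \<open>Agreement of \<^const>\<open>tail\<close> and \<^const>\<open>head\<close> is demanded on the arcs only.\<close>

definition extends :: "('v, 'e) pre_digraph \<Rightarrow> ('v, 'e) pre_digraph \<Rightarrow> bool" where
  "extends D D\<^sub>0 \<longleftrightarrow>
     arcs D\<^sub>0 \<subseteq> arcs D \<and> (\<forall>e \<in> arcs D\<^sub>0. tail D e = tail D\<^sub>0 e \<and> head D e = head D\<^sub>0 e)"

text \<open>The numeral type \<^typ>\<open>3\<close> is the ring of integers modulo 3.\<close>

definition net_out_degree :: "('v, 'e) pre_digraph \<Rightarrow> 'v \<Rightarrow> 3" where
  "net_out_degree D v = of_nat (out_degree D v) - of_nat (in_degree D v)"

definition zero_sum :: "('v, 'e) pre_multigraph \<Rightarrow> ('v \<Rightarrow> 3) \<Rightarrow> bool" where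
  "zero_sum G \<beta> \<longleftrightarrow> (\<Sum>v \<in> vertices G. \<beta> v) = 0"

definition beta_orientation ::
  "('v, 'e) pre_multigraph \<Rightarrow> ('v \<Rightarrow> 3) \<Rightarrow> ('v, 'e) pre_digraph \<Rightarrow> bool" where
  "beta_orientation G \<beta> D \<longleftrightarrow>
     orientation_of G D \<and> (\<forall>v \<in> vertices G. net_out_degree D v = \<beta> v)"

definition mod3_orientation :: "('v, 'e) pre_multigraph \<Rightarrow> ('v, 'e) pre_digraph \<Rightarrow> bool" where
  "mod3_orientation G D \<longleftrightarrow> beta_orientation G (\<lambda>_. 0) D"

definition M3_extendable_at :: "('v, 'e) pre_multigraph \<Rightarrow> 'v \<Rightarrow> bool" where
  "M3_extendable_at G z \<longleftrightarrow>
     (\<forall>D\<^sub>0. pre_orientation_at G z D\<^sub>0 \<and> [out_degree D\<^sub>0 z = in_degree D\<^sub>0 z] (mod 3) \<longrightarrow>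
        (\<exists>D. mod3_orientation G D \<and> extends D D\<^sub>0))"

definition Z3_extendable_at :: "('v, 'e) pre_multigraph \<Rightarrow> 'v \<Rightarrow> bool" where
  "Z3_extendable_at G z \<longleftrightarrow>
     (\<forall>\<beta> D\<^sub>0. zero_sum G \<beta> \<and> pre_orientation_at G z D\<^sub>0 \<and> net_out_degree D\<^sub>0 z = \<beta> z \<longrightarrow>
        (\<exists>D. beta_orientation G \<beta> D \<and> extends D D\<^sub>0))"

end

(* Deleting z and absorbing its pre-oriented edges into the prescription, it suffices to show that
   G - z has an orientation with any prescribed zero-sum net out-degrees modulo 3.

   (1) Every partition P of V(G - z) satisfies the Nash-Williams-Tutte condition for four
   edge-disjoint spanning trees, i.e. the cuts of its parts have total size at least 8(|P| - 1): by
   discharging, since an edge joining parts with cuts of sizes a and b satisfies 1/a + 1/b <= 1/4.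
   Indeed a part with a cut of size at most 7 is a single vertex, and 23-edge-connectivity forces
   a + b >= 25 for its neighbours; a few small configurations are treated separately.

   (2) A minimal graph satisfying this condition but without the required orientation contains no
   proper nontrivial induced subgraph satisfying it (contract that subgraph). This makes all cuts
   of size at least 6, apart from vertices of degree 5, of which the ones with prescription 3 modulo
   6 are removed by lifting one pair of edges and deleting the other three.

   (3) What remains is covered by a theorem of Lovasz, Thomassen, Wu and Zhang, proved by induction
   with a vertex whose incident edges are pre-oriented. In a minimal counterexample tight cuts are
   contracted, so all cuts are large except at single vertices; there pairs of edges are lifted, and
   edges are deleted or replaced by pre-oriented ones, until no configuration is left. *)

theory Submission
  imports Defs "HOL-Library.Disjoint_Sets" "HOL-Library.Multiset"
begin

text \<open>The constant 23 is what the discharging needs: a vertex with a cut of size 5 joined to a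
  part with a cut of size b gives a union with a cut of size at most 5 + b - 2, so 23 yields b >=
  20, and 1/5 + 1/20 is exactly 1/4. Vertices of degree 5 rule out a direct appeal to a theorem
  about cuts of size at least 6, whereas the partition condition survives contraction and still
  produces such cuts: in a graph without proper nontrivial dense subgraphs each side of a cut, if
  nontrivial, misses its own partition bound by at least 2 (parity), so twice the cut is at least 8
  + 2 + 2. The cut bound 4 + \<open>nrm\<close> is then met because of parity: residue 3 forces an
  odd cut, hence one of size at least 7. A pre-oriented vertex is needed in the induction because,
  once the outside of a tight cut has been oriented, the edges of that cut are fixed when the inside
  is treated; tightness bounds their number by 4 + 3.\<close>

text \<open>The distance to the nearest multiple of 6. Since the net out-degree of a vertex has the
  parity of its degree, prescribing it modulo 3 is the same as prescribing it modulo 6.\<close>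

definition nrm :: "int \<Rightarrow> int" where
  "nrm r = min (r mod 6) ((- r) mod 6)"

lemma nrm_cong: "6 dvd a - b \<Longrightarrow> nrm a = nrm b"
  unfolding nrm_def by (metis mod_eq_dvd_iff mod_minus_eq)

lemma nrm_minus [simp]: "nrm (- a) = nrm a"
  by (simp add: nrm_def min.commute)

lemma nrm_ge_0 [simp]: "0 \<le> nrm a"
  by (simp add: nrm_def)

lemma nrm_mod: "nrm a = (if a mod 6 \<le> 3 then a mod 6 else 6 - a mod 6)"
proof -
  have "(- a) mod 6 = (if a mod 6 = 0 then 0 else 6 - a mod 6)"
    by (simp add: zmod_zminus1_eq_if)
  moreover have "0 \<le> a mod 6" "a mod 6 < 6" by auto
  ultimately show ?thesis by (auto simp: nrm_def)
qed

lemma nrm_le_3 [simp]: "nrm a \<le> 3"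
  by (simp add: nrm_mod)

lemma nrm_const [simp]: "nrm 0 = 0" "nrm 1 = 1"
  by (simp_all add: nrm_def)

text \<open>Reversing an orientation negates residues; \<open>s\<close> records the reversal after
  which the residue lies between 0 and 3.\<close>

lemma nrm_sign:
  obtains s :: int where "s = 1 \<or> s = -1" "(s * a) mod 6 = nrm a"
proof (cases "a mod 6 \<le> 3")
  case True
  then show ?thesis using that[of 1] by (simp add: nrm_mod)
next
  case False
  then show ?thesis using that[of "-1"] by (simp add: nrm_mod zmod_zminus1_eq_if)
qed

lemma nrm_residue: "\<exists>k. a = 6 * k + nrm a \<or> a = 6 * k - nrm a"
proof -
  have "a = 6 * (a div 6) + a mod 6" by simp
  then have "a = 6 * (a div 6) + nrm a \<or> a = 6 * (a div 6 + 1) - nrm a"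
    unfolding nrm_mod by (simp split: if_splits)
  then show ?thesis by blast
qed

lemma nrm_parity: "even (nrm a) \<longleftrightarrow> even a"
proof -
  obtain k where "a = 6 * k + nrm a \<or> a = 6 * k - nrm a" using nrm_residue by blast
  then show ?thesis by presburger
qed

lemma nrm_le: assumes "6 dvd a - r" shows "nrm a \<le> \<bar>r\<bar>"
proof (cases "\<bar>r\<bar> \<le> 3")
  case True
  then have "r = -3 \<or> r = -2 \<or> r = -1 \<or> r = 0 \<or> r = 1 \<or> r = 2 \<or> r = 3" by arith
  then have "nrm r \<le> \<bar>r\<bar>" by (elim disjE) (simp_all add: nrm_mod)
  then show ?thesis using nrm_cong[OF assms] by simp
next
  case False then show ?thesis using nrm_le_3[of a] by linarith
qed

lemma nrm_eq_0_iff: "nrm a = 0 \<longleftrightarrow> 6 dvd a"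
proof
  assume "nrm a = 0"
  then show "6 dvd a" using nrm_residue[of a] by auto
next
  assume "6 dvd a"
  then show "nrm a = 0" using nrm_le[of a 0] nrm_ge_0[of a] by auto
qed

lemma nrm_triangle: "nrm (a + b) \<le> nrm a + nrm b"
proof -
  obtain k l where k: "a = 6 * k + nrm a \<or> a = 6 * k - nrm a"
    and l: "b = 6 * l + nrm b \<or> b = 6 * l - nrm b" using nrm_residue by meson
  define r where "r = a + b - 6 * (k + l)"
  have "6 dvd (a + b) - r" by (simp add: r_def)
  moreover have "\<bar>r\<bar> \<le> nrm a + nrm b"
    using k l nrm_ge_0[of a] nrm_ge_0[of b] unfolding r_def by (smt (verit))
  ultimately show ?thesis using nrm_le by fastforce
qed

section \<open>Cuts in multigraphs whose edges are two-element sets\<close>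

text \<open>Phrased without cardinalities so that it commutes with images and preimages for
  arbitrary sets: under \<open>collapse\<close> an edge may become a singleton, which crosses
  nothing.\<close>

definition crosses :: "'v set \<Rightarrow> 'v set \<Rightarrow> bool" where
  "crosses e A \<longleftrightarrow> \<not> e \<subseteq> A \<and> e \<inter> A \<noteq> {}"

definition cut :: "'v set multiset \<Rightarrow> 'v set \<Rightarrow> int" where
  "cut E A = int (size (filter_mset (\<lambda>e. crosses e A) E))"

lemma cut_empty [simp]: "cut {#} A = 0"
  by (simp add: cut_def)

lemma cut_add_mset [simp]: "cut (add_mset e E) A = of_bool (crosses e A) + cut E A"
  by (simp add: cut_def)

lemma cut_union [simp]: "cut (E + F) A = cut E A + cut F A"
  by (simp add: cut_def)

lemma cut_nonneg [simp]: "0 \<le> cut E A"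
  by (simp add: cut_def)

lemma crosses_pair: "crosses {x, y} A \<longleftrightarrow> (x \<in> A) \<noteq> (y \<in> A)"
  by (auto simp: crosses_def)

lemma cut_filter_split: "cut E A = cut (filter_mset P E) A + cut (filter_mset (\<lambda>e. \<not> P e) E) A"
  by (metis cut_union multiset_partition)

definition mgraph :: "'v set \<Rightarrow> 'v set multiset \<Rightarrow> bool" where
  "mgraph V E \<longleftrightarrow> finite V \<and> (\<forall>e \<in># E. e \<subseteq> V \<and> card e = 2)"

lemma mgraph_add_mset: "mgraph V (add_mset e E) \<longleftrightarrow> mgraph V E \<and> e \<subseteq> V \<and> card e = 2"
  by (auto simp: mgraph_def)

lemma mgraph_finite: "mgraph V E \<Longrightarrow> finite V"
  by (simp add: mgraph_def)

lemma mgraph_induct [consumes 1, case_names empty add]: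
  assumes "mgraph V E" and "P {#}"
    and "\<And>x y E. \<lbrakk>mgraph V E; x \<in> V; y \<in> V; x \<noteq> y; P E\<rbrakk> \<Longrightarrow> P (add_mset {x, y} E)"
  shows "P E"
  using assms(1)
proof (induction E)
  case empty show ?case by fact
next
  case (add e E)
  then have "e \<subseteq> V" "card e = 2" "mgraph V E" by (auto simp: mgraph_add_mset)
  then obtain x y where "e = {x, y}" "x \<noteq> y" by (meson card_2_iff)
  with \<open>e \<subseteq> V\<close> \<open>mgraph V E\<close> add.IH assms(3) show ?case by simp
qed

text \<open>An edge with both ends in \<open>A\<close> contributes 2 to the sum of degrees and 0 to
  the cut; every other edge contributes equally to both.\<close>

lemma cut_parity:
  assumes "mgraph V E" "finite A"
  shows "even (cut E A - (\<Sum>v\<in>A. cut E {v}))"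
  using assms(1)
proof (induction rule: mgraph_induct)
  case (add x y E)
  have "(\<Sum>v\<in>A. of_bool (crosses {x, y} {v})) = (of_bool (x \<in> A) + of_bool (y \<in> A) :: int)"
  proof -
    have "(\<Sum>v\<in>A. of_bool (crosses {x, y} {v})) = (\<Sum>v\<in>A. of_bool (v = x) + (of_bool (v = y) :: int))"
      using add.hyps by (intro sum.cong) (auto simp: crosses_pair)
    also have "\<dots> = of_bool (x \<in> A) + of_bool (y \<in> A)"
      using assms(2) by (simp add: sum.distrib of_bool_def)
    finally show ?thesis .
  qed
  then show ?case using add.IH by (auto simp: sum.distrib crosses_pair)
qed simp

lemma cut_compl:
  assumes "mgraph V E" "A \<subseteq> V"
  shows "cut E (V - A) = cut E A"
  using assms(1)
  by (induction rule: mgraph_induct) (use assms(2) in \<open>auto simp: crosses_pair\<close>)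

lemma cut_whole: "mgraph V E \<Longrightarrow> cut E V = 0"
  using cut_compl[of V E V] cut_compl[of V E "{}"] by (simp add: cut_def crosses_def)

lemma cut_cong_Int:
  assumes "mgraph V E" "A \<inter> V = B \<inter> V"
  shows "cut E A = cut E B"
proof -
  have "crosses e A = crosses e B" if "e \<in># E" for e
  proof -
    have "e \<subseteq> V" using that assms(1) by (auto simp: mgraph_def)
    then show ?thesis using assms(2) unfolding crosses_def by blast
  qed
  then show ?thesis unfolding cut_def by (metis (mono_tags, lifting) filter_mset_cong)
qed

section \<open>Orientations as multisets of ordered pairs\<close>

definition und :: "'v \<times> 'v \<Rightarrow> 'v set" where
  "und p = {fst p, snd p}"

definition net :: "('v \<times> 'v) multiset \<Rightarrow> 'v \<Rightarrow> int" where
  "net F v = (\<Sum>p\<in>#F. of_bool (fst p = v) - of_bool (snd p = v))"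

lemma net_simps [simp]:
  "net {#} v = 0"
  "net (add_mset p F) v = of_bool (fst p = v) - of_bool (snd p = v) + net F v"
  "net (F + F') v = net F v + net F' v"
  by (auto simp: net_def)

text \<open>Edges carry no names here: an orientation is any multiset of pairs that projects onto
  \<open>E\<close>, so parallel edges are interchangeable.\<close>

definition sol :: "'v set \<Rightarrow> 'v set multiset \<Rightarrow> ('v \<Rightarrow> int) \<Rightarrow> bool" where
  "sol V E b \<longleftrightarrow> (\<exists>F. image_mset und F = E \<and> (\<forall>v\<in>V. 6 dvd net F v - b v))"

lemma sol_cong:
  assumes "sol V E b" "\<And>v. v \<in> V \<Longrightarrow> 6 dvd b v - b' v"
  shows "sol V E b'"
proof -
  obtain F where F: "image_mset und F = E" "\<forall>v\<in>V. 6 dvd net F v - b v"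
    using assms(1) by (auto simp: sol_def)
  have "6 dvd net F v - b' v" if "v \<in> V" for v
    using dvd_add[of 6 "net F v - b v" "b v - b' v"] F(2) assms(2) that by simp
  then show ?thesis using F(1) unfolding sol_def by blast
qed

text \<open>The edge is oriented in advance, from \<open>x\<close> to \<open>w\<close> if
  \<open>s = 1\<close>; its contribution, \<open>s\<close> at \<open>x\<close> and \<open>-s\<close>
  at \<open>w\<close>, is subtracted from the prescription.\<close>

lemma sol_delete:
  assumes "sol V E (\<lambda>v. b v - s * of_bool (v = x) + s * of_bool (v = w))" "s = 1 \<or> s = -1"
  shows "sol V (add_mset {x, w} E) b"
proof -
  obtain F where F: "image_mset und F = E"
    "\<forall>v\<in>V. 6 dvd net F v - (b v - s * of_bool (v = x) + s * of_bool (v = w))"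
    using assms by (auto simp: sol_def)
  let ?F = "add_mset (if s = 1 then (x, w) else (w, x)) F"
  have "image_mset und ?F = add_mset {x, w} E" using F(1) by (auto simp: und_def)
  moreover have "net ?F v - b v = net F v - (b v - s * of_bool (v = x) + s * of_bool (v = w))" for v
    using assms(2) by auto
  then have "\<forall>v\<in>V. 6 dvd net ?F v - b v" using F(2) by metis
  ultimately show ?thesis unfolding sol_def by blast
qed

text \<open>The arc between \<open>x\<close> and \<open>y\<close> is replaced by a directed path
  through \<open>v\<close>, which enters and leaves \<open>v\<close> once, so no net out-degree
  changes.\<close>

lemma sol_lift:
  assumes "sol V (add_mset {x, y} E) b"
  shows "sol V (add_mset {x, v} (add_mset {v, y} E)) b"
proof -
  obtain F where F: "image_mset und F = add_mset {x, y} E" "\<forall>u\<in>V. 6 dvd net F u - b u"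
    using assms by (auto simp: sol_def)
  then obtain q F' where q: "F = add_mset q F'" "und q = {x, y}" "image_mset und F' = E"
    by (metis msed_map_invR)
  then have "q = (x, y) \<or> q = (y, x)" by (cases q) (auto simp: und_def doubleton_eq_iff)
  then obtain q1 q2 where "und q1 = {x, v}" "und q2 = {v, y}"
    and n: "\<And>u. (of_bool (fst q1 = u) - of_bool (snd q1 = u)) + (of_bool (fst q2 = u) - of_bool (snd q2 = u))
       = (of_bool (fst q = u) - of_bool (snd q = u) :: int)"
  proof (elim disjE, goal_cases)
    case 1 show ?case by (rule 1(1)[of "(x, v)" "(v, y)"]) (use 1 in \<open>auto simp: und_def\<close>)
  next
    case 2 show ?case by (rule 2(1)[of "(v, x)" "(y, v)"]) (use 2 in \<open>auto simp: und_def\<close>)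
  qed
  then have "image_mset und (add_mset q1 (add_mset q2 F')) = add_mset {x, v} (add_mset {v, y} E)"
    using q by simp
  moreover have "net (add_mset q1 (add_mset q2 F')) u = net F u" for u
    using n[of u] q(1) by simp
  ultimately show ?thesis using F(2) unfolding sol_def by (metis (no_types, lifting))
qed

lemma net_outside:
  assumes "mgraph A E" "image_mset und F = E" "v \<notin> A"
  shows "net F v = 0"
proof -
  have "\<forall>p\<in>#F. und p \<subseteq> A"
    using assms(1,2) by (auto simp: mgraph_def)
  then have "\<forall>p\<in>#F. fst p \<noteq> v \<and> snd p \<noteq> v"
    using assms(3) unfolding und_def by blast
  then show ?thesis by (induction F) auto
qed

lemma net_degree:
  assumes "mgraph V E" "image_mset und F = E"
  shows "even (net F v - cut E {v}) \<and> \<bar>net F v\<bar> \<le> cut E {v}"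
  using assms
proof (induction F arbitrary: E)
  case (add q F)
  obtain x y where q: "q = (x, y)" by force
  have E: "E = add_mset {x, y} (image_mset und F)" using add.prems(2) q by (auto simp: und_def[of "(x, y)"])
  then have "mgraph V (image_mset und F)" "x \<noteq> y" using add.prems(1) by (auto simp: mgraph_add_mset)
  then have "even (net F v - cut (image_mset und F) {v}) \<and> \<bar>net F v\<bar> \<le> cut (image_mset und F) {v}"
    using add.IH by blast
  then show ?case using \<open>x \<noteq> y\<close> by (auto simp: E q crosses_pair)
qed auto

lemma sol_combine:
  assumes "mgraph V E" "A \<subseteq> V"
    and F: "image_mset und F = filter_mset (\<lambda>e. \<not> e \<subseteq> A) E"
    and out: "\<And>v. v \<in> V - A \<Longrightarrow> 6 dvd net F v - b v"
    and "sol A (filter_mset (\<lambda>e. e \<subseteq> A) E) (\<lambda>v. b v - net F v)"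
  shows "sol V E b"
proof -
  obtain F' where F': "image_mset und F' = filter_mset (\<lambda>e. e \<subseteq> A) E"
    "\<forall>v\<in>A. 6 dvd net F' v - (b v - net F v)"
    using assms(5) by (auto simp: sol_def)
  have "mgraph A (filter_mset (\<lambda>e. e \<subseteq> A) E)"
    using assms(1,2) by (auto simp: mgraph_def finite_subset)
  then have z: "net F' v = 0" if "v \<notin> A" for v using net_outside F'(1) that by metis
  have "image_mset und (F' + F) = E" using F F'(1) by (metis image_mset_union multiset_partition)
  moreover have "6 dvd net (F' + F) v - b v" if "v \<in> V" for v
    using F'(2) out[of v] z[of v] that by (cases "v \<in> A") (auto simp: algebra_simps)
  ultimately show ?thesis unfolding sol_def by blast
qed

section \<open>Identification and contraction of vertices\<close>

text \<open>Without edge names it has to be chosen which oriented image belongs to which edge; the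
  induction chooses one edge at a time.\<close>

lemma lift_orientation:
  assumes "image_mset und F' = image_mset ((`) \<phi>) E" "\<forall>e\<in>#E. card e = 2"
  shows "\<exists>F. image_mset und F = E \<and> image_mset (map_prod \<phi> \<phi>) F = F'"
  using assms
proof (induction E arbitrary: F')
  case (add e E)
  from add.prems(1) have "image_mset und F' = add_mset (\<phi> ` e) (image_mset ((`) \<phi>) E)" by simp
  from msed_map_invR[OF this] obtain q F1
    where q: "F' = add_mset q F1" "und q = \<phi> ` e" "image_mset und F1 = image_mset ((`) \<phi>) E"
    by auto
  obtain F where F: "image_mset und F = E" "image_mset (map_prod \<phi> \<phi>) F = F1"
    using add.IH[OF q(3)] add.prems(2) by auto
  obtain x y where e: "e = {x, y}" using add.prems(2) by (metis card_2_iff union_single_eq_member)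
  have "q = (\<phi> x, \<phi> y) \<or> q = (\<phi> y, \<phi> x)"
    using q(2) e by (cases q) (auto simp: und_def doubleton_eq_iff)
  then have "\<exists>r. und r = e \<and> map_prod \<phi> \<phi> r = q"
  proof
    assume "q = (\<phi> x, \<phi> y)"
    then show ?thesis using e by (intro exI[of _ "(x, y)"]) (simp add: und_def)
  next
    assume "q = (\<phi> y, \<phi> x)"
    then show ?thesis using e by (intro exI[of _ "(y, x)"]) (auto simp: und_def)
  qed
  then obtain r where "und r = e" "map_prod \<phi> \<phi> r = q" by blast
  then have "image_mset und (add_mset r F) = add_mset e E \<and> image_mset (map_prod \<phi> \<phi>) (add_mset r F) = F'"
    using F q(1) by simp
  then show ?case by blast
qed simp

lemma net_image:
  assumes "mgraph V E" "image_mset und F = E"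
  shows "net (image_mset (map_prod \<phi> \<phi>) F) u = (\<Sum>v | v \<in> V \<and> \<phi> v = u. net F v)"
  using assms
proof (induction F arbitrary: E)
  case (add q F)
  obtain x y where q: "q = (x, y)" by force
  have E: "E = add_mset {x, y} (image_mset und F)" using add.prems(2) q by (auto simp: und_def[of "(x, y)"])
  have fin: "finite V" using add.prems(1) mgraph_finite by blast
  have V: "x \<in> V" "y \<in> V" using add.prems(1) E by (auto simp: mgraph_add_mset)
  have s: "(\<Sum>v | v \<in> V \<and> \<phi> v = u. of_bool (x = v)) = (of_bool (\<phi> x = u) :: int)" if "x \<in> V" for x
    using fin that by (simp add: of_bool_def sum.delta)
  have "net (image_mset (map_prod \<phi> \<phi>) F) u = (\<Sum>v | v \<in> V \<and> \<phi> v = u. net F v)"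
    using add.IH[of "image_mset und F"] add.prems(1) by (simp add: E mgraph_add_mset)
  then show ?case using s[OF V(1)] s[OF V(2)] by (simp add: q sum.distrib sum_subtractf)
qed simp

definition collapse :: "'v set \<Rightarrow> 'v \<Rightarrow> 'v \<Rightarrow> 'v" where
  "collapse A a v = (if v \<in> A then a else v)"

text \<open>Edges inside \<open>A\<close> would become loops and are dropped first. The new vertex
  is a member \<open>a\<close> of \<open>A\<close>, so no fresh name is needed.\<close>

definition contract :: "'v set \<Rightarrow> 'v \<Rightarrow> 'v set multiset \<Rightarrow> 'v set multiset" where
  "contract A a E = image_mset ((`) (collapse A a)) (filter_mset (\<lambda>e. \<not> e \<subseteq> A) E)"

text \<open>At the contracted vertex only the total over \<open>A\<close> is controlled; the errors
  at the individual vertices of \<open>A\<close> are left to the edges inside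
  \<open>A\<close>.\<close>

lemma contract_orientation:
  assumes g: "mgraph V E" and A: "A \<subseteq> V" "a \<in> A"
    and s: "sol (insert a (V - A)) (contract A a E) b'"
    and b': "b' a = sum b A" "\<And>v. v \<in> V - A \<Longrightarrow> b' v = b v"
  obtains F where "image_mset und F = filter_mset (\<lambda>e. \<not> e \<subseteq> A) E"
    "\<And>v. v \<in> V - A \<Longrightarrow> 6 dvd net F v - b v"
    "6 dvd (\<Sum>v\<in>A. net F v) - sum b A"
proof -
  let ?E = "filter_mset (\<lambda>e. \<not> e \<subseteq> A) E"
  obtain F' where F': "image_mset und F' = contract A a E"
    "\<forall>v\<in>insert a (V - A). 6 dvd net F' v - b' v" using s by (auto simp: sol_def)
  have g': "mgraph V ?E" using g by (auto simp: mgraph_def)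
  obtain F where F: "image_mset und F = ?E" "image_mset (map_prod (collapse A a) (collapse A a)) F = F'"
    using lift_orientation[of F' "collapse A a" ?E] F'(1) g' by (auto simp: contract_def mgraph_def)
  have n: "net F' u = (\<Sum>v | v \<in> V \<and> collapse A a v = u. net F v)" for u
    using net_image[OF g' F(1), of "collapse A a" u] F(2) by simp
  have "{v \<in> V. collapse A a v = a} = A" using A by (auto simp: collapse_def)
  then have 1: "6 dvd (\<Sum>v\<in>A. net F v) - sum b A" using n[of a] F'(2) b'(1) by auto
  have "{v \<in> V. collapse A a v = u} = {u}" if "u \<in> V - A" for u
    using A that by (auto simp: collapse_def)
  then have "6 dvd net F u - b u" if "u \<in> V - A" for u
    using n[of u] bspec[OF F'(2), of u] b'(2)[OF that] that by simp
  then show ?thesis using 1 F(1) that by blast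
qed

lemma contract_mgraph:
  assumes "mgraph V E" "A \<subseteq> V" "a \<in> A"
  shows "mgraph (insert a (V - A)) (contract A a E)"
proof -
  have "collapse A a ` e \<subseteq> insert a (V - A) \<and> card (collapse A a ` e) = 2"
    if "e \<in># E" "\<not> e \<subseteq> A" for e
  proof -
    have e: "e \<subseteq> V" "card e = 2" using that assms by (auto simp: mgraph_def)
    then obtain x y where "e = {x, y}" "x \<noteq> y" by (meson card_2_iff)
    have "collapse A a x \<noteq> collapse A a y"
      using \<open>e = {x, y}\<close> \<open>x \<noteq> y\<close> that(2) assms(3) by (auto simp: collapse_def)
    moreover have "collapse A a ` e \<subseteq> insert a (V - A)" using e(1) by (auto simp: collapse_def)
    ultimately show ?thesis using \<open>e = {x, y}\<close> by simp
  qed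
  then show ?thesis using assms(1) by (simp add: contract_def mgraph_def)
qed

lemma cut_contract: "cut (contract A a E) S = cut E (collapse A a -` S)"
proof (induction E)
  case (add e E)
  have "crosses (collapse A a ` e) S = crosses e (collapse A a -` S)"
    by (auto simp: crosses_def)
  moreover have "\<not> crosses e (collapse A a -` S)" if "e \<subseteq> A"
    using that by (fastforce simp: crosses_def collapse_def)
  ultimately show ?case using add by (auto simp: contract_def)
qed (simp add: contract_def)

lemma size_contract: "size (contract A a E) \<le> size E"
  by (simp add: contract_def size_filter_mset_lesseq)

text \<open>Two parallel edges realize -2, 0 and 2 at \<open>u\<close>, which are all even residues
  modulo 6. Every further edge is simply oriented from \<open>u\<close> to \<open>v\<close>.\<close>

lemma sol_parallel:
  assumes "n \<ge> 2" "u \<noteq> v" "even (b u - int n)" "6 dvd b u + b v"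
  shows "sol {u, v} (replicate_mset n {u, v}) b"
  using assms(1,3,4)
proof (induction n arbitrary: b rule: dec_induct)
  case base
  have base: "sol {u, v} (replicate_mset 2 {u, v}) b" if "6 dvd b u - r - s" "r = 1 \<or> r = -1" "s = 1 \<or> s = -1" for r s
  proof -
    have "6 dvd b v + r + s" using dvd_diff[OF base.prems(2) that(1)] by (simp add: algebra_simps)
    then have "sol {u, v} {#} (\<lambda>w. b w - r * of_bool (w = u) + r * of_bool (w = v)
        - s * of_bool (w = u) + s * of_bool (w = v))"
      using that(1) \<open>u \<noteq> v\<close> unfolding sol_def
      by (intro exI[of _ "{#}"]) (auto simp: dvd_diff_commute algebra_simps dest: dvd_minus_iff[THEN iffD2])
    then have "sol {u, v} {#{u, v}#} (\<lambda>w. b w - r * of_bool (w = u) + r * of_bool (w = v))"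
      using that(3) by (rule sol_delete)
    then show ?thesis using that(2) by (simp add: numeral_2_eq_2 sol_delete)
  qed
  have "even (b u)" using base.prems(1) by simp
  then have "6 dvd b u \<or> 6 dvd b u - 2 \<or> 6 dvd b u + 2" by presburger
  then show ?case using base[of 1 "-1"] base[of 1 1] base[of "-1" "-1"] by (auto simp: add.commute)
next
  case (step n)
  have "sol {u, v} (replicate_mset n {u, v}) (\<lambda>w. b w - 1 * of_bool (w = u) + 1 * of_bool (w = v))"
    by (rule step.IH) (use step.prems \<open>u \<noteq> v\<close> in auto)
  from sol_delete[OF this] show ?case by simp
qed

lemma parallel_edges:
  assumes "mgraph {u, v} E"
  shows "E = replicate_mset (size E) {u, v}"
proof -
  have "e = {u, v}" if "e \<in># E" for e
  proof (rule card_seteq)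
    show "e \<subseteq> {u, v}" "card {u, v} \<le> card e"
      using that assms by (auto simp: mgraph_def card_insert_if)
  qed simp
  then show ?thesis by (induction E) auto
qed

text \<open>The edges not inside \<open>A\<close> are oriented first, with an outcome at the
  vertices of \<open>A\<close> that cannot be foreseen. Hence \<open>inner\<close> asks for every
  prescription on \<open>A\<close> of the right parity and sum.\<close>

lemma sol_contract:
  assumes g: "mgraph V E" and A: "A \<subseteq> V" "a \<in> A"
    and par: "\<And>v. v \<in> V \<Longrightarrow> even (b v - cut E {v})"
    and s: "sol (insert a (V - A)) (contract A a E) b'"
    and b': "b' a = sum b A" "\<And>v. v \<in> V - A \<Longrightarrow> b' v = b v"
    and inner: "\<And>b2. (\<And>v. v \<in> A \<Longrightarrow> even (b2 v - cut (filter_mset (\<lambda>e. e \<subseteq> A) E) {v})) \<Longrightarrow> 6 dvd sum b2 A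
       \<Longrightarrow> sol A (filter_mset (\<lambda>e. e \<subseteq> A) E) b2"
  shows "sol V E b"
proof -
  obtain F where F: "image_mset und F = filter_mset (\<lambda>e. \<not> e \<subseteq> A) E"
    "\<And>v. v \<in> V - A \<Longrightarrow> 6 dvd net F v - b v" "6 dvd (\<Sum>v\<in>A. net F v) - sum b A"
    using contract_orientation[OF g A s b'] by metis
  have g': "mgraph V (filter_mset (\<lambda>e. \<not> e \<subseteq> A) E)" using g by (auto simp: mgraph_def)
  show ?thesis
  proof (rule sol_combine[OF g A(1) F(1,2)])
    show "sol A (filter_mset (\<lambda>e. e \<subseteq> A) E) (\<lambda>v. b v - net F v)"
    proof (rule inner)
      fix v assume "v \<in> A"
      then have "even (b v - cut E {v})" using par A by auto
      moreover have "even (net F v - cut (filter_mset (\<lambda>e. \<not> e \<subseteq> A) E) {v})"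
        using net_degree[OF g' F(1)] by blast
      ultimately show "even (b v - net F v - cut (filter_mset (\<lambda>e. e \<subseteq> A) E) {v})"
        using cut_filter_split[of E "{v}" "\<lambda>e. e \<subseteq> A"] by auto
    next
      show "6 dvd (\<Sum>v\<in>A. b v - net F v)"
        using F(3) by (simp add: sum_subtractf dvd_diff_commute)
    qed
  qed auto
qed

definition csum :: "'v set \<Rightarrow> 'v \<Rightarrow> ('v \<Rightarrow> int) \<Rightarrow> 'v \<Rightarrow> int" where
  "csum A a f v = (if v = a then sum f A else f v)"

lemma sol_contract_parallel:
  assumes g: "mgraph V E" and uv: "u \<noteq> v" and E: "E = add_mset {u, v} (add_mset {u, v} E')"
    and par: "\<And>w. w \<in> V \<Longrightarrow> even (b w - cut E {w})"
    and s: "sol (insert u (V - {u, v})) (contract {u, v} u E) (csum {u, v} u b)"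
  shows "sol V E b"
proof -
  have V: "{u, v} \<subseteq> V" using g E by (auto simp: mgraph_def)
  let ?I = "filter_mset (\<lambda>e. e \<subseteq> {u, v}) E"
  have "mgraph {u, v} ?I" using g by (auto simp: mgraph_def)
  then have I: "?I = replicate_mset (size ?I) {u, v}" by (rule parallel_edges)
  have "size ?I \<ge> 2" using E by simp
  show ?thesis
  proof (rule sol_contract[OF g V _ par s])
    fix b2 assume b2: "\<And>w. w \<in> {u, v} \<Longrightarrow> even (b2 w - cut ?I {w})" "6 dvd sum b2 {u, v}"
    have "cut (replicate_mset n {u, v}) {u} = int n" for n
      using uv by (induction n) (auto simp: crosses_pair)
    then have "cut ?I {u} = int (size ?I)" using I by metis
    then have "even (b2 u - int (size ?I))" using b2(1)[of u] by simp
    moreover have "6 dvd b2 u + b2 v" using b2(2) uv by simp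
    ultimately show "sol {u, v} ?I b2"
      using sol_parallel[OF \<open>size ?I \<ge> 2\<close> uv] I by metis
  qed (auto simp: csum_def)
qed

lemma sol_single_vertex:
  assumes "mgraph {v} E" "6 dvd b v"
  shows "sol {v} E b"
proof -
  have "e \<notin># E" for e
  proof
    assume "e \<in># E"
    then have "e \<subseteq> {v}" "card e = 2" using assms(1) by (auto simp: mgraph_def)
    then show False using card_mono[of "{v}" e] by simp
  qed
  then have "E = {#}" by (meson multiset_nonemptyE)
  then show ?thesis using assms(2) unfolding sol_def by (intro exI[of _ "{#}"]) simp
qed

text \<open>For a set \<open>S\<close> of vertices of the contracted graph this is its preimage
  under \<open>collapse A a\<close>.\<close>

definition preim :: "'v set \<Rightarrow> 'v \<Rightarrow> 'v set \<Rightarrow> 'v set" where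
  "preim A a S = (S - {a}) \<union> (if a \<in> S then A else {})"

lemma sum_csum:
  assumes "finite V" "A \<subseteq> V" "S \<subseteq> insert a (V - A)" "a \<in> A"
  shows "sum (csum A a f) S = sum f (preim A a S)"
proof -
  have fin: "finite S" "finite A" using assms by (meson finite_Diff finite_insert finite_subset)+
  have "sum (csum A a f) (S - {a}) = sum f (S - {a})"
    by (rule sum.cong) (auto simp: csum_def)
  moreover have "sum (csum A a f) S = sum (csum A a f) (S - {a}) + (if a \<in> S then sum f A else 0)"
    using fin by (cases "a \<in> S") (auto simp: csum_def sum.remove[of S a])
  moreover have "sum f (preim A a S) = sum f (S - {a}) + (if a \<in> S then sum f A else 0)"
    using assms fin unfolding preim_def by (auto intro!: sum.union_disjoint)
  ultimately show ?thesis by simp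
qed

lemma cut_contract_preim:
  assumes "mgraph V E" "A \<subseteq> V" "S \<subseteq> insert a (V - A)" "a \<in> A"
  shows "cut (contract A a E) S = cut E (preim A a S)"
proof -
  have "collapse A a -` S \<inter> V = preim A a S \<inter> V"
  proof (rule set_eqI)
    fix u show "u \<in> collapse A a -` S \<inter> V \<longleftrightarrow> u \<in> preim A a S \<inter> V"
      using assms by (cases "u \<in> A"; cases "a \<in> S") (auto simp: collapse_def preim_def)
  qed
  then show ?thesis using cut_cong_Int[OF assms(1)] cut_contract by metis
qed

section \<open>Orientations extending a pre-orientation at a deleted vertex\<close>

text \<open>The size of the cut of \<open>A\<close> in the graph with the pre-oriented vertex
  restored, \<open>p\<close> counting the edges to that vertex.\<close>

definition dg :: "'v set multiset \<Rightarrow> ('v \<Rightarrow> int) \<Rightarrow> 'v set \<Rightarrow> int" where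
  "dg E p A = cut E A + sum p A"

text \<open>The vertex \<open>z\<^sub>0\<close> whose edges are oriented in advance is not part of the graph:
  \<open>p v\<close> is the number of edges joining \<open>z\<^sub>0\<close> to \<open>v\<close>, and \<open>h v\<close> is the number of those directed
  towards \<open>z\<^sub>0\<close> minus the number of those directed towards \<open>v\<close>. The prescription \<open>b\<close> concerns
  the remaining edges only, so that \<open>b v + h v\<close> is the prescription at \<open>v\<close> in the whole graph.
  A solution does not depend on \<open>p\<close> and \<open>h\<close>; these may be changed freely as long as the instance
  remains admissible.\<close>

definition admissible :: "'v set \<Rightarrow> 'v set multiset \<Rightarrow> ('v \<Rightarrow> int) \<Rightarrow> ('v \<Rightarrow> int) \<Rightarrow> ('v \<Rightarrow> int) \<Rightarrow> bool" where
  "admissible V E b p h \<longleftrightarrow> mgraph V E \<and> V \<noteq> {} \<and> 6 dvd sum b V \<and>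
     (\<forall>v\<in>V. even (b v - cut E {v}) \<and> \<bar>h v\<bar> \<le> p v \<and> even (p v - h v)) \<and>
     sum p V \<le> 4 + nrm (sum h V) \<and>
     (\<forall>A. A \<noteq> {} \<longrightarrow> A \<subset> V \<longrightarrow> 4 + nrm (\<Sum>v\<in>A. b v + h v) \<le> dg E p A)"

text \<open>A cut has the parity of its prescription \<open>r\<close>, and so has
  \<open>e = nrm r\<close>; a cut above the bound \<open>4 + e\<close> therefore exceeds it by at
  least 2.\<close>

lemma parity_gap:
  fixes d e r :: int
  shows "\<not> 6 + e \<le> d \<Longrightarrow> even (d - r) \<Longrightarrow> even (r - e) \<Longrightarrow> d \<le> 4 + e"
  by presburger

lemma even_sum_diff:
  fixes f g :: "'v \<Rightarrow> int"
  assumes "\<And>v. v \<in> A \<Longrightarrow> even (f v - g v)"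
  shows "even (sum f A - sum g A)"
  unfolding sum_subtractf[symmetric] by (rule dvd_sum) (fact assms)

lemma admissible_parity:
  assumes "admissible V E b p h" "A \<subseteq> V"
  shows "even (dg E p A - (\<Sum>v\<in>A. b v + h v))"
proof -
  have g: "mgraph V E" and fin: "finite A"
    using assms finite_subset by (auto simp: admissible_def mgraph_def)
  have "even (sum b A - (\<Sum>v\<in>A. cut E {v}))"
    by (rule even_sum_diff) (use assms in \<open>auto simp: admissible_def\<close>)
  moreover have "even (sum p A - sum h A)"
    by (rule even_sum_diff) (use assms in \<open>auto simp: admissible_def\<close>)
  ultimately show ?thesis using cut_parity[OF g fin] by (simp add: dg_def sum.distrib)
qed

lemma csum_parity:
  assumes g: "mgraph V E" and A: "A \<subseteq> V" "a \<in> A"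
    and par: "\<And>v. v \<in> V \<Longrightarrow> even (b v - cut E {v})" and v: "v \<in> insert a (V - A)"
  shows "even (csum A a b v - cut (contract A a E) {v})"
proof -
  have "cut (contract A a E) {v} = cut E (preim A a {v})"
    by (rule cut_contract_preim[OF g A(1) _ A(2)]) (use v in auto)
  moreover have "csum A a b v = sum b (preim A a {v})" by (auto simp: csum_def preim_def)
  moreover have sub: "preim A a {v} \<subseteq> V" using v A by (auto simp: preim_def)
  moreover have "finite (preim A a {v})" using sub g finite_subset by (auto simp: mgraph_def)
  moreover have "even (sum b (preim A a {v}) - (\<Sum>v\<in>preim A a {v}. cut E {v}))"
    by (rule even_sum_diff) (use par sub in blast)
  ultimately show ?thesis using cut_parity[OF g, of "preim A a {v}"] by simp
qed

text \<open>A set of vertices of the contraction stands for a set of original vertices containing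
  all or none of \<open>A\<close>, with the same cut and the same sums.\<close>

lemma admissible_contract:
  assumes L: "admissible V E b p h" and A: "A \<subseteq> V" "a \<in> A"
  shows "admissible (insert a (V - A)) (contract A a E) (csum A a b) (csum A a p) (csum A a h)"
proof -
  let ?V = "insert a (V - A)"
  have g: "mgraph V E" and fin: "finite V" using L by (auto simp: admissible_def mgraph_def)
  have pV: "preim A a ?V = V" using A by (auto simp: preim_def)
  note sc = sum_csum[OF fin A(1) _ A(2)]
  have finA: "finite A" using A fin finite_subset by blast
  have cs: "(\<Sum>v\<in>S. csum A a b v + csum A a h v) = (\<Sum>v\<in>preim A a S. b v + h v)" if "S \<subseteq> ?V" for S
    using sc[OF that] by (simp add: sum.distrib)
  have abs: "\<bar>csum A a h v\<bar> \<le> csum A a p v \<and> even (csum A a p v - csum A a h v)" if "v \<in> ?V" for v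
  proof (cases "v = a")
    case True
    have "\<bar>sum h A\<bar> \<le> (\<Sum>v\<in>A. \<bar>h v\<bar>)" by (rule sum_abs)
    also have "\<dots> \<le> sum p A" by (rule sum_mono) (use L A in \<open>auto simp: admissible_def\<close>)
    finally have "\<bar>sum h A\<bar> \<le> sum p A" .
    moreover have "even (sum p A - sum h A)"
      by (rule even_sum_diff) (use L A in \<open>auto simp: admissible_def\<close>)
    ultimately show ?thesis using True by (simp add: csum_def)
  next
    case False
    then show ?thesis using that L by (auto simp: csum_def admissible_def)
  qed
  have par: "even (csum A a b v - cut (contract A a E) {v})" if "v \<in> ?V" for v
    by (rule csum_parity[OF g A _ that]) (use L in \<open>auto simp: admissible_def\<close>)
  have cuts: "4 + nrm (\<Sum>v\<in>S. csum A a b v + csum A a h v) \<le> dg (contract A a E) (csum A a p) S"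
    if "S \<noteq> {}" "S \<subset> ?V" for S
  proof -
    have S: "S \<subseteq> ?V" using that by blast
    have "preim A a S \<noteq> {}" using that A by (auto simp: preim_def)
    moreover have "preim A a S \<subset> V" using that A by (auto simp: preim_def split: if_splits)
    ultimately have "4 + nrm (\<Sum>v\<in>preim A a S. b v + h v) \<le> dg E p (preim A a S)"
      using L by (auto simp: admissible_def)
    then show ?thesis using sc[OF S] cut_contract_preim[OF g A(1) S A(2)] cs[OF S] by (simp add: dg_def)
  qed
  have "mgraph ?V (contract A a E)" by (rule contract_mgraph[OF g A])
  then show ?thesis
    using sc[of ?V] pV L abs par cuts unfolding admissible_def by auto
qed

text \<open>No remaining edge has both ends in \<open>A\<close>, so an edge that meets
  \<open>B\<close> meets it in a single vertex and crosses it.\<close>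

lemma cut_crossing:
  assumes "mgraph V E" "B \<subseteq> A" "finite A"
  shows "cut (filter_mset (\<lambda>e. \<not> e \<subseteq> A) E) B = (\<Sum>v\<in>B. cut (filter_mset (\<lambda>e. \<not> e \<subseteq> A) E) {v})"
  using assms(1)
proof (induction rule: mgraph_induct)
  case (add x y E)
  have fin: "finite B" using assms finite_subset by blast
  have "(\<Sum>v\<in>B. of_bool (crosses {x, y} {v})) = (of_bool (x \<in> B) + of_bool (y \<in> B) :: int)"
  proof -
    have "(\<Sum>v\<in>B. of_bool (crosses {x, y} {v})) = (\<Sum>v\<in>B. of_bool (v = x) + (of_bool (v = y) :: int))"
      using add.hyps by (intro sum.cong) (auto simp: crosses_pair)
    also have "\<dots> = of_bool (x \<in> B) + of_bool (y \<in> B)"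
      using fin by (simp add: sum.distrib of_bool_def)
    finally show ?thesis .
  qed
  moreover have "of_bool (crosses {x, y} B) = (of_bool (x \<in> B) + of_bool (y \<in> B) :: int)" if "\<not> {x, y} \<subseteq> A"
    using that assms(2) by (auto simp: crosses_pair)
  ultimately show ?case using add.IH by (auto simp: sum.distrib)
qed simp

text \<open>The outside of \<open>A\<close> and the old pre-oriented vertex merge into a new
  pre-oriented vertex, the additional edges being oriented by \<open>F\<close>. As \<open>h\<close>
  gains what \<open>b\<close> loses, \<open>b + h\<close> is unchanged, and so are the cuts of
  subsets of \<open>A\<close>; tightness of \<open>A\<close> becomes the bound on the number of
  pre-oriented edges.\<close>

lemma admissible_inner:
  assumes L: "admissible V E b p h" and A: "A \<subseteq> V" "A \<noteq> {}" "A \<noteq> V"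
    and tight: "dg E p A \<le> 4 + nrm (\<Sum>v\<in>A. b v + h v)"
    and F: "image_mset und F = filter_mset (\<lambda>e. \<not> e \<subseteq> A) E" "6 dvd (\<Sum>v\<in>A. net F v) - sum b A"
  shows "admissible A (filter_mset (\<lambda>e. e \<subseteq> A) E) (\<lambda>v. b v - net F v)
    (\<lambda>v. p v + cut (filter_mset (\<lambda>e. \<not> e \<subseteq> A) E) {v}) (\<lambda>v. h v + net F v)"
proof -
  let ?I = "filter_mset (\<lambda>e. e \<subseteq> A) E" and ?O = "filter_mset (\<lambda>e. \<not> e \<subseteq> A) E"
  let ?p = "\<lambda>v. p v + cut ?O {v}"
  have g: "mgraph V E" and fin: "finite A" using L A finite_subset by (auto simp: admissible_def mgraph_def)
  have gO: "mgraph V ?O" and gI: "mgraph A ?I" using g fin by (auto simp: mgraph_def)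
  have d: "dg ?I ?p B = dg E p B" if "B \<subseteq> A" for B
    using cut_crossing[OF g that fin] cut_filter_split[of E B "\<lambda>e. e \<subseteq> A"]
    by (simp add: dg_def sum.distrib)
  have s: "(\<Sum>v\<in>B. b v - net F v + (h v + net F v)) = (\<Sum>v\<in>B. b v + h v)" for B
    by (simp add: algebra_simps)
  have v: "even (b v - net F v - cut ?I {v}) \<and> \<bar>h v + net F v\<bar> \<le> ?p v \<and> even (?p v - (h v + net F v))"
    if "v \<in> A" for v
  proof -
    have "even (b v - cut E {v})" "\<bar>h v\<bar> \<le> p v" "even (p v - h v)" using that L A by (auto simp: admissible_def)
    moreover have "even (net F v - cut ?O {v})" "\<bar>net F v\<bar> \<le> cut ?O {v}"
      using net_degree[OF gO F(1)] by blast+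
    ultimately show ?thesis using cut_filter_split[of E "{v}" "\<lambda>e. e \<subseteq> A"] by auto
  qed
  have z: "6 dvd (\<Sum>v\<in>A. b v - net F v)" using F(2) by (simp add: sum_subtractf dvd_diff_commute)
  have "nrm (\<Sum>v\<in>A. h v + net F v) = nrm (\<Sum>v\<in>A. b v + h v)"
    by (rule nrm_cong) (use F(2) in \<open>simp add: sum.distrib algebra_simps\<close>)
  moreover have "sum ?p A = dg E p A" using d[of A] cut_whole[OF gI] by (simp add: dg_def)
  ultimately have D: "sum ?p A \<le> 4 + nrm (\<Sum>v\<in>A. h v + net F v)" using tight by simp
  have "4 + nrm (\<Sum>v\<in>B. b v - net F v + (h v + net F v)) \<le> dg ?I ?p B" if "B \<noteq> {}" "B \<subset> A" for B
  proof -
    have "B \<subset> V" "B \<subseteq> A" using that A by auto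
    then show ?thesis using that L d[of B] s[of B] by (auto simp: admissible_def)
  qed
  then show ?thesis using gI A(2) z v D unfolding admissible_def by blast
qed

text \<open>An admissible instance has at most 7 pre-oriented edges, so the factor 8 makes the size of
  the graph take precedence over their number.\<close>

definition weight :: "'v set \<Rightarrow> 'v set multiset \<Rightarrow> ('v \<Rightarrow> int) \<Rightarrow> nat" where
  "weight V E p = 8 * (card V + size E) + nat (sum p V)"

section \<open>A minimal counterexample and its tight cuts\<close>

locale minimal_instance =
  fixes V :: "'v set" and E b p h
  assumes L: "admissible V E b p h"
    and IH: "\<And>V' E' b' p' h'. admissible V' E' b' p' h' \<Longrightarrow> weight V' E' p' < weight V E p \<Longrightarrow> sol V' (E' :: 'v set multiset) b'"
    and no_sol: "\<not> sol V E b"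
begin

abbreviation c :: "'v \<Rightarrow> int" where "c \<equiv> \<lambda>v. b v + h v"

lemma g: "mgraph V E" and fin: "finite V" and ne: "V \<noteq> {}"
  using L by (auto simp: admissible_def mgraph_def)

lemma zero: "6 dvd sum b V" using L by (auto simp: admissible_def)

lemma local:
  assumes "v \<in> V"
  shows "even (b v - cut E {v})" "\<bar>h v\<bar> \<le> p v" "even (p v - h v)" "0 \<le> p v"
  using L assms by (auto simp: admissible_def)

lemma total: "sum p V \<le> 4 + nrm (sum h V)" "sum p V \<le> 7" "0 \<le> sum p V"
proof -
  show "sum p V \<le> 4 + nrm (sum h V)" using L by (auto simp: admissible_def)
  then show "sum p V \<le> 7" using nrm_le_3[of "sum h V"] by linarith
  show "0 \<le> sum p V" using local by (simp add: sum_nonneg)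
qed

lemma cV: "nrm (sum c V) = nrm (sum h V)"
  by (rule nrm_cong) (use zero in \<open>simp add: sum.distrib\<close>)

lemma cuts: "A \<noteq> {} \<Longrightarrow> A \<subset> V \<Longrightarrow> 4 + nrm (sum c A) \<le> dg E p A"
  using L by (auto simp: admissible_def)

lemma reduce:
  assumes "admissible V' E' b' p' h'" "card V' + size E' < card V + size E"
  shows "sol V' (E' :: 'v set multiset) b'"
proof (rule IH[OF assms(1)])
  have "sum p' V' \<le> 4 + nrm (sum h' V')" using assms(1) by (auto simp: admissible_def)
  then have "nat (sum p' V') \<le> 7" using nrm_le_3[of "sum h' V'"] by linarith
  then show "weight V' E' p' < weight V E p" using assms(2) by (simp add: weight_def)
qed

lemma card_contract:
  assumes "A \<subseteq> V" "a \<in> A" "card A \<ge> 2"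
  shows "card (insert a (V - A)) < card V"
proof -
  have "card (insert a (V - A)) = Suc (card (V - A))" using assms fin by simp
  also have "card (V - A) = card V - card A" using assms fin by (simp add: card_Diff_subset finite_subset)
  finally show ?thesis using assms card_mono[OF fin assms(1)] by linarith
qed

lemma contracted:
  assumes "A \<subseteq> V" "a \<in> A" "card A \<ge> 2"
  shows "sol (insert a (V - A)) (contract A a E) (csum A a b)"
  by (rule reduce[OF admissible_contract[OF L assms(1,2)]])
    (use card_contract[OF assms] size_contract[of A a E] in linarith)

text \<open>If the cut is tight, the contraction of \<open>A\<close> orients everything outside, and
  the inside with the cut edges pre-oriented is again admissible. The former graph is smaller
  because \<open>A\<close> has two vertices, the latter because \<open>A\<close> is proper.\<close>

lemma nontrivial_cuts:
  assumes "A \<subset> V" "card A \<ge> 2"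
  shows "6 + nrm (sum c A) \<le> dg E p A"
proof (rule ccontr)
  assume "\<not> ?thesis"
  moreover have "even (dg E p A - sum c A)" using admissible_parity[OF L] assms by auto
  moreover have "even (sum c A - nrm (sum c A))" using nrm_parity[of "sum c A"] by simp
  ultimately have t: "dg E p A \<le> 4 + nrm (sum c A)" by (rule parity_gap)
  have sub: "A \<subseteq> V" "A \<noteq> V" and "A \<noteq> {}" using assms by auto
  then obtain a where a: "a \<in> A" by auto
  obtain F where F: "image_mset und F = filter_mset (\<lambda>e. \<not> e \<subseteq> A) E"
    "\<And>v. v \<in> V - A \<Longrightarrow> 6 dvd net F v - b v" "6 dvd (\<Sum>v\<in>A. net F v) - sum b A"
  proof (rule contract_orientation[OF g sub(1) a contracted[OF sub(1) a assms(2)], of b])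
    show "csum A a b a = sum b A" by (simp add: csum_def)
    show "csum A a b v = b v" if "v \<in> V - A" for v using that a by (auto simp: csum_def)
  qed blast
  have "sol A (filter_mset (\<lambda>e. e \<subseteq> A) E) (\<lambda>v. b v - net F v)"
  proof (rule reduce[OF admissible_inner[OF L sub(1) \<open>A \<noteq> {}\<close> sub(2) t F(1,3)]])
    show "card A + size (filter_mset (\<lambda>e. e \<subseteq> A) E) < card V + size E"
      using psubset_card_mono[OF fin assms(1)] size_filter_mset_lesseq[of "\<lambda>e. e \<subseteq> A" E] by linarith
  qed
  then have "sol V E b" using sol_combine[OF g sub(1) F(1,2)] by blast
  then show False using no_sol by blast
qed

text \<open>Two parallel edges realize every prescription of the right parity and sum on their ends,
  so these ends can be contracted and the pair oriented last.\<close>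

lemma simple:
  assumes "u \<noteq> v" "E = add_mset {u, v} (add_mset {u, v} E')"
  shows False
proof -
  have "{u, v} \<subseteq> V" using g assms(2) by (auto simp: mgraph_def)
  then have "sol (insert u (V - {u, v})) (contract {u, v} u E) (csum {u, v} u b)"
    by (rule contracted) (use assms(1) in auto)
  then have "sol V E b" using sol_contract_parallel[OF g assms local(1)] by blast
  then show False using no_sol by blast
qed

end

lemma cut_edge:
  assumes "mgraph V E" "cut E A \<ge> 1"
  obtains x w E' where "x \<in> A" "w \<notin> A" "E = add_mset {x, w} E'" "x \<noteq> w" "x \<in> V" "w \<in> V"
proof -
  have "filter_mset (\<lambda>e. crosses e A) E \<noteq> {#}"
  proof
    assume "filter_mset (\<lambda>e. crosses e A) E = {#}"
    then show False using assms(2) unfolding cut_def by (metis int_ops(1) not_one_le_zero size_empty)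
  qed
  then obtain e where "e \<in># filter_mset (\<lambda>e. crosses e A) E" by (rule multiset_nonemptyE)
  then have e: "e \<in># E" "crosses e A" by simp_all
  then have V: "e \<subseteq> V" "card e = 2" using assms(1) by (auto simp: mgraph_def)
  then obtain x w where xw: "e = {x, w}" "x \<noteq> w" by (meson card_2_iff)
  obtain E' where E': "E = add_mset e E'" using e(1) by (metis insert_DiffM)
  show ?thesis
  proof (cases "x \<in> A")
    case True
    then show ?thesis using that[of x w E'] xw V E' e(2) by (auto simp: crosses_pair)
  next
    case False
    then show ?thesis using that[of w x E'] xw V E' e(2) by (auto simp: crosses_pair insert_commute)
  qed
qed

lemma sol_extend:
  assumes "sol V' E b" "mgraph V' E" "\<And>v. v \<in> V - V' \<Longrightarrow> 6 dvd b v"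
  shows "sol V E b"
proof -
  obtain F where F: "image_mset und F = E" "\<forall>v\<in>V'. 6 dvd net F v - b v" using assms(1) by (auto simp: sol_def)
  have "6 dvd net F v - b v" if "v \<in> V" for v
  proof (cases "v \<in> V'")
    case False
    then show ?thesis using net_outside[OF assms(2) F(1) False] assms(3)[of v] that by auto
  qed (use F in auto)
  then show ?thesis using F(1) unfolding sol_def by blast
qed

lemma mgraph_remove_isolated:
  assumes "mgraph V E" "cut E {v} = 0"
  shows "mgraph (V - {v}) E"
proof -
  have "\<not> crosses e {v}" if "e \<in># E" for e
    using assms(2) that by (auto simp: cut_def dest: filter_mset_eq_mempty_iff[THEN iffD1])
  moreover have "e \<noteq> {v}" if "e \<in># E" for e using assms(1) that by (auto simp: mgraph_def)
  ultimately have "v \<notin> e" if "e \<in># E" for e using that unfolding crosses_def by blast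
  then show ?thesis using assms(1) by (auto simp: mgraph_def)
qed

lemma admissibleI:
  assumes "mgraph V E" "V \<noteq> {}" "6 dvd sum b V" "\<And>v. v \<in> V \<Longrightarrow> even (b v - cut E {v})"
    "\<And>v. v \<in> V \<Longrightarrow> \<bar>h v\<bar> \<le> p v" "\<And>v. v \<in> V \<Longrightarrow> even (p v - h v)"
    "sum p V \<le> 4 + nrm (sum h V)"
    "\<And>A. A \<noteq> {} \<Longrightarrow> A \<subset> V \<Longrightarrow> 4 + nrm (\<Sum>v\<in>A. b v + h v) \<le> dg E p A"
  shows "admissible V E b p h"
  using assms by (simp add: admissible_def)

lemma sum_indicator:
  assumes "finite A"
  shows "(\<Sum>v\<in>A. k * of_bool (v = x)) = (k * of_bool (x \<in> A) :: int)"
    and "(\<Sum>v\<in>A. of_bool (v = x)) = (of_bool (x \<in> A) :: int)"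
proof -
  show 1: "(\<Sum>v\<in>A. k * of_bool (v = x)) = (k * of_bool (x \<in> A) :: int)" for k
    using assms by (simp add: of_bool_def if_distrib cong: if_cong)
  show "(\<Sum>v\<in>A. of_bool (v = x)) = (of_bool (x \<in> A) :: int)" using 1[of 1] by simp
qed

text \<open>At residue 3 both signs lead towards a multiple of 6, at residue 0 neither does; at
  every other residue exactly one does.\<close>

lemma nrm_step:
  assumes "s = 1 \<or> s = -1"
  shows "nrm (a - s) = nrm a + (if (s * a) mod 6 \<in> {1, 2, 3} then -1 else 1)"
proof -
  have 1: "nrm (a - 1) = nrm a + (if a mod 6 \<in> {1, 2, 3} then -1 else 1)" for a
  proof -
    define r where "r = a mod 6"
    have "0 \<le> r" "r < 6" by (auto simp: r_def)
    then have "r = 0 \<or> r = 1 \<or> r = 2 \<or> r = 3 \<or> r = 4 \<or> r = 5" by arith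
    then have "nrm (r - 1) = nrm r + (if r mod 6 \<in> {1, 2, 3} then -1 else 1)"
      by (elim disjE) (simp_all add: nrm_mod)
    moreover have "nrm (a - 1) = nrm (r - 1)" "nrm a = nrm r"
      by (rule nrm_cong; simp add: r_def minus_mod_eq_mult_div)+
    ultimately show ?thesis by (simp add: r_def)
  qed
  show ?thesis
  proof (cases "s = 1")
    case False
    then have s: "s = -1" using assms by auto
    have "nrm (- a - 1) = nrm (a - s)" using nrm_minus[of "a + 1"] by (simp add: s)
    then show ?thesis using 1[of "- a"] by (simp add: s)
  qed (use 1 in simp)
qed

lemma nrm_mult_sign: "s = 1 \<or> s = -1 \<Longrightarrow> nrm (s * a) = nrm a"
  by auto

section \<open>Small cuts and lifting: every single vertex is tight\<close>

context minimal_instance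
begin

text \<open>Adding the bounds for \<open>A\<close> and its complement,
  \<open>2 * cut E A + sum p V\<close> is at least 8 plus the \<open>nrm\<close> of the total, while
  \<open>sum p V\<close> is at most 4 plus it. The slack of 2 at a nontrivial complement gives one
  edge more.\<close>

lemma cut_ge_2:
  assumes "A \<noteq> {}" "A \<subset> V"
  shows "2 \<le> cut E A"
    and "2 \<le> card (V - A) \<Longrightarrow> 3 \<le> cut E A"
proof -
  have A: "V - A \<noteq> {}" "V - A \<subset> V" "A \<subseteq> V" using assms by auto
  have fA: "finite A" using A fin finite_subset by blast
  have sp: "sum p A + sum p (V - A) = sum p V" "sum c A + sum c (V - A) = sum c V"
    using sum.subset_diff[OF A(3) fin] by (metis add.commute)+
  have n: "nrm (sum c V) \<le> nrm (sum c A) + nrm (sum c (V - A))" using nrm_triangle sp(2) by metis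
  have 1: "4 + nrm (sum c A) \<le> cut E A + sum p A" using cuts[OF assms] by (simp add: dg_def)
  have cc: "cut E (V - A) = cut E A" using cut_compl[OF g A(3)] .
  have 2: "4 + nrm (sum c (V - A)) \<le> cut E A + sum p (V - A)" using cuts[OF A(1,2)] cc by (simp add: dg_def)
  show "2 \<le> cut E A" using 1 2 n sp total(1) cV by linarith
  assume "2 \<le> card (V - A)"
  then have "6 + nrm (sum c (V - A)) \<le> cut E A + sum p (V - A)"
    using nontrivial_cuts[OF A(2)] cc by (simp add: dg_def)
  then show "3 \<le> cut E A" using 1 n sp total(1) cV by linarith
qed

lemma no_parallel: "E = add_mset {u, v} (add_mset {u, w} E') \<Longrightarrow> u \<noteq> v \<Longrightarrow> v \<noteq> w"
  using simple by auto

lemma card_ge_3: "3 \<le> card V"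
proof (rule ccontr)
  assume n: "\<not> ?thesis"
  obtain v where v: "v \<in> V" using ne by auto
  show False
  proof (cases "V = {v}")
    case True
    then have "sol V E b" using sol_single_vertex[of v E b] g zero by simp
    then show False using no_sol by blast
  next
    case False
    then have "{v} \<subset> V" using v by auto
    have "2 \<le> cut E {v}" using cut_ge_2(1)[of "{v}"] \<open>{v} \<subset> V\<close> by auto
    then have "1 \<le> cut E {v}" by simp
    from cut_edge[OF g this] obtain x E1 where x: "E = add_mset {v, x} E1" "v \<noteq> x" "x \<in> V"
      by (metis singletonD)
    have "1 \<le> cut E1 {v}" using \<open>2 \<le> cut E {v}\<close> x by (simp add: crosses_pair)
    moreover have "mgraph V E1" using g x by (simp add: mgraph_add_mset)
    ultimately obtain y E2 where y: "E1 = add_mset {v, y} E2" "v \<noteq> y" "y \<in> V"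
      using cut_edge[of V E1 "{v}"] by (metis singletonD)
    have "x \<noteq> y" using no_parallel x y by blast
    then have "card {v, x, y} = 3" using x y by auto
    then have "3 \<le> card V" using card_mono[OF fin, of "{v, x, y}"] v x y by auto
    then show False using n by blast
  qed
qed

lemma card_remove: "v \<in> V \<Longrightarrow> 2 \<le> card (V - {v})"
  using card_ge_3 fin by simp

lemma proper_singleton: "v \<in> V \<Longrightarrow> {v} \<subset> V"
  using card_ge_3 by auto

lemma three_edges:
  assumes "v \<in> V"
  obtains x y w E' where "E = add_mset {v, x} (add_mset {v, y} (add_mset {v, w} E'))"
    "v \<noteq> x" "v \<noteq> y" "v \<noteq> w" "x \<noteq> y" "x \<noteq> w" "y \<noteq> w" "x \<in> V" "y \<in> V" "w \<in> V"
proof -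
  have 3: "3 \<le> cut E {v}" using cut_ge_2(2)[of "{v}"] proper_singleton[OF assms] card_remove[OF assms] by auto
  then have "1 \<le> cut E {v}" by simp
  from cut_edge[OF g this] obtain x E1 where x: "E = add_mset {v, x} E1" "v \<noteq> x" "x \<in> V"
    by (metis singletonD)
  have 2: "2 \<le> cut E1 {v}" using 3 x by (simp add: crosses_pair)
  have g1: "mgraph V E1" using g x by (simp add: mgraph_add_mset)
  obtain y E2 where y: "E1 = add_mset {v, y} E2" "v \<noteq> y" "y \<in> V"
    using cut_edge[OF g1, of "{v}"] 2 by (metis order_trans one_le_numeral singletonD)
  have 1: "1 \<le> cut E2 {v}" using 2 y by (simp add: crosses_pair)
  have g2: "mgraph V E2" using g1 y by (simp add: mgraph_add_mset)
  obtain w E3 where w: "E2 = add_mset {v, w} E3" "v \<noteq> w" "w \<in> V"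
    using cut_edge[OF g2 1] by (metis singletonD)
  have E: "E = add_mset {v, x} (add_mset {v, y} (add_mset {v, w} E3))" using x y w by simp
  moreover have "x \<noteq> y" "x \<noteq> w" "y \<noteq> w"
    using no_parallel[of v x y] no_parallel[of v x w "add_mset {v, y} E3"] no_parallel[of v y w "add_mset {v, x} E3"] E x y w
    by (auto simp: add_mset_commute)
  ultimately show ?thesis using that x y w by blast
qed

lemma cut_lift:
  assumes "x \<noteq> v" "y \<noteq> v"
  shows "cut (add_mset {v, x} (add_mset {v, y} E0)) A =
    cut (add_mset {x, y} E0) A + (if (x \<in> A) = (y \<in> A) \<and> (v \<in> A) \<noteq> (x \<in> A) then 2 else 0)"
  by (auto simp: crosses_pair)

lemma singleton_or_nontrivial:
  assumes "A \<noteq> {}" "A \<subset> V" shows "(\<exists>v\<in>V. A = {v}) \<or> 2 \<le> card A"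
proof -
  have "finite A" using assms fin finite_subset by blast
  then have "card A \<noteq> 0" using assms by auto
  then consider "card A = 1" | "2 \<le> card A" by linarith
  then show ?thesis
  proof cases
    case 1
    then obtain v where "A = {v}" by (rule card_1_singletonE)
    then show ?thesis using assms by auto
  qed blast
qed

text \<open>If \<open>v\<close> had slack, parity would make it at least 2, and two edges
  \<open>vx\<close>, \<open>vy\<close> could be lifted. Only cuts separating \<open>v\<close> from
  both \<open>x\<close> and \<open>y\<close> shrink, by 2; as \<open>x\<close> and \<open>y\<close>
  differ, such a set is \<open>{v}\<close> or nontrivial, and these have slack 2.\<close>

lemma singleton_tight:
  assumes "v \<in> V"
  shows "dg E p {v} = 4 + nrm (c v)"
proof (rule ccontr)
  assume n: "\<not> ?thesis"
  have lb: "4 + nrm (c v) \<le> dg E p {v}" using cuts[of "{v}"] proper_singleton[OF assms] by simp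
  have "even (dg E p {v} - c v)" using admissible_parity[OF L, of "{v}"] assms by simp
  moreover have "even (c v - nrm (c v))" using nrm_parity[of "c v"] by simp
  ultimately have big: "6 + nrm (c v) \<le> dg E p {v}" using n lb parity_gap by fastforce
  obtain x y w E' where E: "E = add_mset {v, x} (add_mset {v, y} (add_mset {v, w} E'))"
    "v \<noteq> x" "v \<noteq> y" "v \<noteq> w" "x \<noteq> y" "x \<in> V" "y \<in> V"
    using three_edges[OF assms] by metis
  let ?R = "add_mset {v, w} E'"
  let ?E = "add_mset {x, y} ?R"
  have cl: "cut E A = cut ?E A + (if (x \<in> A) = (y \<in> A) \<and> (v \<in> A) \<noteq> (x \<in> A) then 2 else 0)" for A
    using cut_lift[of x v y ?R A] E by simp
  have gE: "mgraph V ?E" using g E by (auto simp: mgraph_def)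
  have loc: "even (b u - cut ?E {u})" if "u \<in> V" for u
    using local(1)[OF that] cl[of "{u}"] by (auto split: if_splits)
  have "4 + nrm (sum c A) \<le> dg ?E p A" if A: "A \<noteq> {}" "A \<subset> V" for A
  proof (cases "cut ?E A = cut E A")
    case True then show ?thesis using cuts[OF A] by (simp add: dg_def)
  next
    case False
    then have sep: "(x \<in> A) = (y \<in> A)" "(v \<in> A) \<noteq> (x \<in> A)" and eq: "cut E A = cut ?E A + 2"
      using cl[of A] by (auto split: if_splits)
    have "6 + nrm (sum c A) \<le> dg E p A"
      using singleton_or_nontrivial[OF A]
    proof
      assume "\<exists>u\<in>V. A = {u}"
      then have "A = {v}" using sep E by auto
      then show ?thesis using big by simp
    qed (rule nontrivial_cuts[OF A(2)])
    then show ?thesis using eq by (simp add: dg_def)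
  qed
  then have "admissible V ?E b p h"
    by (intro admissibleI gE ne zero loc local total)
  then have "sol V ?E b" by (rule reduce) (simp add: E(1))
  then have "sol V E b" using sol_lift[of V x y ?R b v] E(1) by (simp add: insert_commute)
  then show False using no_sol by blast
qed

end

lemma parity_gap_le:
  fixes d e r :: int
  shows "even (d - r) \<Longrightarrow> even (r - e) \<Longrightarrow> d \<le> 4 + e \<Longrightarrow> d \<noteq> 4 + e \<Longrightarrow> d + 2 \<le> 4 + e"
  by presburger

lemma abs_diff_sign:
  fixes a m s :: int
  assumes "s = 1 \<or> s = -1" "a \<noteq> - s * m" "\<bar>a\<bar> \<le> m" "even (m - a)"
  shows "\<bar>a - s\<bar> \<le> m - 1" "1 \<le> m"
  using assms by (elim disjE; simp; presburger)+

section \<open>Vertices of residue 0, and deletion of edges\<close>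

context minimal_instance
begin

text \<open>By tightness \<open>v\<close> has degree 4, edges to the pre-oriented vertex included,
  and at least 3 of these lie in \<open>E\<close>. The four edges are lifted in two pairs, which
  removes \<open>v\<close>. If \<open>p v = 1\<close>, one pair contains the pre-oriented edge,
  whose end moves from \<open>v\<close> to a neighbour \<open>w\<close>.\<close>

lemma no_zero_vertex:
  assumes v: "v \<in> V" and c0: "6 dvd c v"
  shows False
proof -
  have d4: "cut E {v} + p v = 4"
    using singleton_tight[OF v] c0 nrm_eq_0_iff[of "c v"] by (simp add: dg_def)
  obtain x y w E1 where E: "E = add_mset {v, x} (add_mset {v, y} (add_mset {v, w} E1))"
    and d: "v \<noteq> x" "v \<noteq> y" "v \<noteq> w" "x \<noteq> y" "x \<noteq> w" "y \<noteq> w" and V: "x \<in> V" "y \<in> V" "w \<in> V"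
    using three_edges[OF v] by metis
  have cv: "cut E {v} = 3 + cut E1 {v}" using E d by (simp add: crosses_pair)
  let ?V = "V - {v}"
  have ne': "?V \<noteq> {}" using card_remove[OF v] by (metis card.empty not_numeral_le_zero)
  have rem: "sum f V = f v + sum f ?V" for f :: "'v \<Rightarrow> int" using sum.remove[OF fin v] .
  have gE1: "mgraph V E1" using g E by (simp add: mgraph_add_mset)
  have "p v = 0 \<or> p v = 1" using d4 cv local(4)[OF v] cut_nonneg[of E1 "{v}"] by linarith
  then show False
  proof
    assume p0: "p v = 0"
    then have h0: "h v = 0" using local(2)[OF v] by simp
    have "1 \<le> cut E1 {v}" using d4 cv p0 by simp
    then obtain z E2 where z: "E1 = add_mset {v, z} E2" "v \<noteq> z" "z \<in> V"
      using cut_edge[OF gE1] by (metis singletonD)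
    have c2: "cut E2 {v} = 0" using d4 cv p0 z by (simp add: crosses_pair)
    have wz: "w \<noteq> z" using no_parallel[of v w z "add_mset {v, x} (add_mset {v, y} E2)"] E z d
      by (simp add: add_mset_commute)
    have g2: "mgraph ?V E2" using mgraph_remove_isolated[of V E2 v] c2 gE1 z by (simp add: mgraph_add_mset)
    let ?E = "add_mset {x, y} (add_mset {w, z} E2)"
    have gE: "mgraph ?V ?E" using g2 V d z wz by (simp add: mgraph_add_mset)
    have cl: "cut E A = cut ?E A + (if x \<in> A \<and> y \<in> A then 2 else 0) + (if w \<in> A \<and> z \<in> A then 2 else 0)"
      if "v \<notin> A" for A
      using that E z by (auto simp: crosses_pair)
    have "sol ?V ?E b"
    proof (rule reduce[of _ _ _ p h])
      show "card ?V + size ?E < card V + size E" using fin v E z by (simp add: card_Diff_singleton)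
      show "admissible ?V ?E b p h"
      proof (rule admissibleI[OF gE ne'])
        show "6 dvd sum b ?V" using zero c0 rem[of b] h0 by (metis add.right_neutral dvd_add_right_iff)
        show "even (b u - cut ?E {u})" if "u \<in> ?V" for u
          using local(1)[of u] cl[of "{u}"] that d wz by (auto split: if_splits)
        show "\<bar>h u\<bar> \<le> p u" "even (p u - h u)" if "u \<in> ?V" for u using local that by auto
        show "sum p ?V \<le> 4 + nrm (sum h ?V)" using total(1) rem[of p] rem[of h] p0 h0 by simp
        fix A assume A: "A \<noteq> {}" "A \<subset> ?V"
        then have AV: "A \<subset> V" "v \<notin> A" by auto
        have fA: "finite A" using AV fin finite_subset by blast
        show "4 + nrm (sum c A) \<le> dg ?E p A"
        proof (cases "x \<in> A \<and> y \<in> A \<and> w \<in> A \<and> z \<in> A")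
          case True
          \<comment> \<open>A set containing all four neighbours loses 4 by the two lifts, more than
            its slack. Adding \<open>v\<close> gives a set whose cut is that of \<open>A\<close>
            after lifting, with the same residue because 6 divides \<open>c v\<close>.\<close>
          let ?B = "insert v A"
          have "cut E ?B = cut ?E A"
            using True E z AV(2) d c2 g2 by (auto simp: crosses_pair intro: cut_cong_Int)
          moreover have "sum p ?B = sum p A" "nrm (sum c ?B) = nrm (sum c A)"
            using fA AV p0 c0 by (auto intro: nrm_cong)
          moreover have "4 + nrm (sum c ?B) \<le> dg E p ?B" by (rule cuts) (use A v in auto)
          ultimately show ?thesis by (simp add: dg_def)
        next
          case False
          show ?thesis
          proof (cases "cut E A = cut ?E A")
            case True
            then show ?thesis using cuts[OF A(1) AV(1)] by (simp add: dg_def)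
          next
            case neq: False
            then have two: "(x \<in> A \<and> y \<in> A) \<or> (w \<in> A \<and> z \<in> A)" and eq: "cut E A = cut ?E A + 2"
              using cl[OF AV(2)] False by (auto split: if_splits)
            then have "2 \<le> card A"
              using card_mono[OF fA, of "{x, y}"] card_mono[OF fA, of "{w, z}"] d wz by auto
            then show ?thesis using nontrivial_cuts[OF AV(1)] eq by (simp add: dg_def)
          qed
        qed
      qed
    qed
    then have "sol V ?E b" using sol_extend[OF _ gE] c0 h0 by force
    then have "sol V (add_mset {x, v} (add_mset {v, y} (add_mset {w, z} E2))) b" by (rule sol_lift)
    then have "sol V (add_mset {w, z} (add_mset {x, v} (add_mset {v, y} E2))) b" by (simp add: add_mset_commute)
    then have "sol V (add_mset {w, v} (add_mset {v, z} (add_mset {x, v} (add_mset {v, y} E2)))) b" by (rule sol_lift)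
    then have "sol V E b" using E z by (simp add: add_mset_commute insert_commute)
    then show False using no_sol by blast
  next
    assume p1: "p v = 1"
    then have h1: "h v = 1 \<or> h v = -1" using local(2,3)[OF v] by auto presburger
    have c1: "cut E1 {v} = 0" using d4 cv p1 by simp
    have g1: "mgraph ?V E1" using mgraph_remove_isolated[OF gE1 c1] .
    let ?E = "add_mset {x, y} E1"
    \<comment> \<open>The edge \<open>vw\<close> continues the pre-oriented arc at \<open>v\<close>,
      so \<open>w\<close> receives a pre-oriented edge of that direction and \<open>b + h\<close>
      does not change at \<open>w\<close>.\<close>
    let ?b = "\<lambda>u. b u - h v * of_bool (u = w)" and ?h = "\<lambda>u. h u + h v * of_bool (u = w)"
    let ?p = "\<lambda>u. p u + 1 * of_bool (u = w)"
    have gE: "mgraph ?V ?E" using g1 V d by (simp add: mgraph_add_mset)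
    have cl: "cut E A = cut ?E A + (if x \<in> A \<and> y \<in> A then 2 else 0) + of_bool (w \<in> A)"
      if "v \<notin> A" for A
      using that E by (auto simp: crosses_pair)
    have finV: "finite ?V" using fin by simp
    have "sol ?V ?E ?b"
    proof (rule reduce[of _ _ _ ?p ?h])
      show "card ?V + size ?E < card V + size E" using fin v E by (simp add: card_Diff_singleton)
      show "admissible ?V ?E ?b ?p ?h"
      proof (rule admissibleI[OF gE ne'])
        have "sum ?b ?V = sum b V - c v"
          using rem[of b] V d sum_indicator(1)[OF finV, of "h v" w] by (simp add: sum_subtractf)
        then show "6 dvd sum ?b ?V" using zero c0 by (simp add: dvd_diff)
        show "even (?b u - cut ?E {u})" if "u \<in> ?V" for u
          using local(1)[of u] cl[of "{u}"] that d h1 by (auto split: if_splits)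
        show "\<bar>?h u\<bar> \<le> ?p u" "even (?p u - ?h u)" if "u \<in> ?V" for u
          using local[of u] that h1 by auto
        have "sum ?p ?V = sum p V" "sum ?h ?V = sum h V"
          using rem[of p] rem[of h] V d sum_indicator[OF finV] p1 by (simp_all add: sum.distrib)
        then show "sum ?p ?V \<le> 4 + nrm (sum ?h ?V)" using total(1) by simp
        fix A assume A: "A \<noteq> {}" "A \<subset> ?V"
        then have AV: "A \<subset> V" "v \<notin> A" by auto
        have fA: "finite A" using AV fin finite_subset by blast
        have s: "(\<Sum>u\<in>A. ?b u + ?h u) = sum c A" by (rule sum.cong) auto
        have sp: "sum ?p A = sum p A + of_bool (w \<in> A)" using sum_indicator[OF fA] by (simp add: sum.distrib)
        show "4 + nrm (\<Sum>u\<in>A. ?b u + ?h u) \<le> dg ?E ?p A"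
        proof (cases "x \<in> A \<and> y \<in> A")
          case True
          then have "2 \<le> card A" using card_mono[OF fA, of "{x, y}"] d by auto
          then show ?thesis using nontrivial_cuts[OF AV(1)] cl[OF AV(2)] True s sp by (simp add: dg_def)
        next
          case False
          have "cut E A = cut ?E A + of_bool (w \<in> A)" using cl[OF AV(2)] unfolding if_not_P[OF False] by simp
          then show ?thesis using cuts[OF A(1) AV(1)] unfolding s dg_def sp by linarith
        qed
      qed
    qed
    then have "sol ?V ?E (\<lambda>u. b u - (- h v) * of_bool (u = v) + (- h v) * of_bool (u = w))"
      by (rule sol_cong) auto
    then have "sol V ?E (\<lambda>u. b u - (- h v) * of_bool (u = v) + (- h v) * of_bool (u = w))"
    proof (rule sol_extend[OF _ gE])
      fix u assume "u \<in> V - ?V"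
      then have "u = v" by auto
      then show "6 dvd b u - (- h v) * of_bool (u = v) + (- h v) * of_bool (u = w)"
        using c0 d by simp
    qed
    then have "sol V (add_mset {v, w} ?E) b" by (rule sol_delete) (use h1 in auto)
    then have "sol V (add_mset {x, y} (add_mset {v, w} E1)) b" by (simp add: add_mset_commute)
    then have "sol V (add_mset {x, v} (add_mset {v, y} (add_mset {v, w} E1))) b" by (rule sol_lift)
    then have "sol V E b" using E by (simp add: insert_commute)
    then show False using no_sol by blast
  qed
qed

text \<open>The edge \<open>{x, w}\<close> is deleted and oriented from \<open>x\<close> to \<open>w\<close> if \<open>s = 1\<close>; at the same
  time the numbers of pre-oriented edges at \<open>x\<close> and \<open>w\<close> are raised by \<open>i\<close> and \<open>k\<close>.\<close>

lemma delete_edge: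
  assumes E: "E = add_mset {x, w} E1" and xw: "x \<noteq> w" and s: "s = 1 \<or> s = -1"
    and ik: "0 \<le> i" "0 \<le> k" "even (i - j)" "even (k - l)"
    and hp: "\<bar>h x + j\<bar> \<le> p x + i" "\<bar>h w + l\<bar> \<le> p w + k"
    and shift: "nrm (j - s) \<le> 1 + i" "nrm (l + s) \<le> 1 + k"
    and single: "nrm (c x + (j - s)) \<le> nrm (c x) + i - 1" "nrm (c w + (l + s)) \<le> nrm (c w) + k - 1"
    and D: "sum p V + i + k \<le> 4 + nrm (sum h V + j + l)"
  shows False
proof -
  have V: "x \<in> V" "w \<in> V" and g1: "mgraph V E1" using g E by (auto simp: mgraph_add_mset)
  let ?b = "\<lambda>u. b u - s * of_bool (u = x) + s * of_bool (u = w)"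
  \<comment> \<open>\<open>j\<close> and \<open>l\<close> are the changes of \<open>h\<close>, so
    the prescription in the whole graph changes by \<open>j - s\<close> at \<open>x\<close> and by
    \<open>l + s\<close> at \<open>w\<close>. Single vertices are tight and need
    \<open>single\<close>; larger sets have slack 2, for which \<open>shift\<close>
    suffices.\<close>
  let ?h = "\<lambda>u. h u + j * of_bool (u = x) + l * of_bool (u = w)"
  let ?p = "\<lambda>u. p u + i * of_bool (u = x) + k * of_bool (u = w)"
  note si = sum_indicator
  have sp: "sum ?p A = sum p A + i * of_bool (x \<in> A) + k * of_bool (w \<in> A)" if "finite A" for A
    using si[OF that] by (simp add: sum.distrib)
  have "sol V E1 ?b"
  proof (rule reduce[of _ _ _ ?p ?h])
    show "card V + size E1 < card V + size E" by (simp add: E)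
    show "admissible V E1 ?b ?p ?h"
    proof (rule admissibleI[OF g1 ne])
      show "6 dvd sum ?b V" using zero si[OF fin] V by (simp add: sum.distrib sum_subtractf)
      show "even (?b u - cut E1 {u})" if "u \<in> V" for u
        using local(1)[OF that] s xw by (auto simp: E crosses_pair split: if_splits)
      show "\<bar>?h u\<bar> \<le> ?p u" "even (?p u - ?h u)" if "u \<in> V" for u
        using local[OF that] hp ik xw by auto
      show "sum ?p V \<le> 4 + nrm (sum ?h V)" using D si[OF fin] V by (simp add: sum.distrib)
      fix A assume A: "A \<noteq> {}" "A \<subset> V"
      then have fA: "finite A" using fin finite_subset by blast
      have sc: "(\<Sum>u\<in>A. ?b u + ?h u) = sum c A + ((j - s) * of_bool (x \<in> A) + (l + s) * of_bool (w \<in> A))"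
        using si[OF fA] by (simp add: sum.distrib sum_subtractf algebra_simps)
      have d: "dg E1 ?p A = dg E p A - of_bool ((x \<in> A) \<noteq> (w \<in> A)) + i * of_bool (x \<in> A) + k * of_bool (w \<in> A)"
        using sp[OF fA] by (simp add: dg_def E crosses_pair)
      show "4 + nrm (\<Sum>u\<in>A. ?b u + ?h u) \<le> dg E1 ?p A"
        using singleton_or_nontrivial[OF A]
      proof
        assume "\<exists>u\<in>V. A = {u}"
        then obtain u where u: "u \<in> V" "A = {u}" by blast
        then have t: "dg E p A = 4 + nrm (c u)" using singleton_tight by simp
        consider "u = x" | "u = w" | "u \<noteq> x" "u \<noteq> w" by blast
        then show ?thesis
        proof cases
          case 1
          then show ?thesis unfolding sc d using t u xw single(1) by simp
        next
          case 2
          then show ?thesis unfolding sc d using t u xw single(2) by simp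
        next
          case 3
          then show ?thesis unfolding sc d using t u by simp
        qed
      next
        assume "2 \<le> card A"
        then have big: "6 + nrm (sum c A) \<le> dg E p A" using nontrivial_cuts[OF A(2)] by blast
        have tri: "nrm (sum c A + r) \<le> nrm (sum c A) + nrm r" for r by (rule nrm_triangle)
        have "nrm ((j - s) + (l + s)) \<le> nrm (j - s) + nrm (l + s)" by (rule nrm_triangle)
        then show ?thesis unfolding sc d
          using big shift ik tri[of 0] tri[of "j - s"] tri[of "l + s"] tri[of "(j - s) + (l + s)"]
          by (cases "x \<in> A"; cases "w \<in> A") simp_all
      qed
    qed
  qed
  then have "sol V E b" unfolding E using s by (rule sol_delete)
  then show False using no_sol by blast
qed

lemma edge_at:
  assumes "v \<in> V"
  obtains w E1 where "E = add_mset {v, w} E1" "v \<noteq> w" "w \<in> V"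
  using three_edges[OF assms] by metis

text \<open>Otherwise parity leaves room for two more pre-oriented edges. An arbitrary edge
  \<open>xw\<close> is rerouted through the pre-oriented vertex, which leaves \<open>b + h\<close>
  unchanged everywhere and makes \<open>E\<close> smaller.\<close>

lemma extremal_total: "sum p V = 4 + nrm (sum h V)"
proof (rule ccontr)
  assume n: "\<not> ?thesis"
  have "even (sum p V - sum h V)" by (rule even_sum_diff) (rule local)
  moreover have "even (sum h V - nrm (sum h V))" using nrm_parity[of "sum h V"] by simp
  ultimately have D: "sum p V + 2 \<le> 4 + nrm (sum h V)" using total(1) n by (rule parity_gap_le)
  obtain x where x: "x \<in> V" using ne by auto
  obtain w E1 where E: "E = add_mset {x, w} E1" "x \<noteq> w" "w \<in> V" using edge_at[OF x] .
  show False
    by (rule delete_edge[OF E(1,2), of 1 1 1 1 "-1"]) (use local(2)[OF x] local(2)[OF E(3)] D in auto)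
qed

section \<open>Favourable directions at the vertices and the contradiction\<close>

text \<open>An arc leaving \<open>v\<close> (\<open>s = 1\<close>) or entering \<open>v\<close>
  (\<open>s = -1\<close>) brings the residue of what remains prescribed closer to 0, which makes up
  for the lost edge. Both signs are good exactly at residue 3.\<close>

definition good :: "int \<Rightarrow> 'v \<Rightarrow> bool" where
  "good s v \<longleftrightarrow> (s * c v) mod 6 \<in> {1, 2, 3}"

lemma good_nrm: "s = 1 \<or> s = -1 \<Longrightarrow> good s v \<Longrightarrow> nrm (c v - s) = nrm (c v) - 1"
  using nrm_step[of s "c v"] by (simp add: good_def)

lemma good_or: "v \<in> V \<Longrightarrow> good 1 v \<or> good (-1) v"
proof -
  assume "v \<in> V"
  then have "\<not> 6 dvd c v" using no_zero_vertex by blast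
  then have "c v mod 6 \<noteq> 0" by (simp add: dvd_eq_mod_eq_0)
  moreover have "0 \<le> c v mod 6" "c v mod 6 < 6" by auto
  moreover have "(- c v) mod 6 = 6 - c v mod 6" using calculation(1)
    by (subst zmod_zminus1_eq_if) simp
  ultimately show ?thesis unfolding good_def by auto
qed

text \<open>Otherwise an edge \<open>vw\<close> could be oriented to suit \<open>v\<close> and
  replaced at \<open>w\<close> by a pre-oriented edge of the same direction. One more pre-oriented
  edge is allowed, as the bound on their number grows by one as well.\<close>

lemma not_good_if_growing:
  assumes s: "s = 1 \<or> s = -1" and v: "v \<in> V" and grow: "nrm (sum h V - s) = nrm (sum h V) + 1"
  shows "\<not> good s v"
proof
  assume gd: "good s v"
  obtain w E1 where E: "E = add_mset {v, w} E1" "v \<noteq> w" "w \<in> V" using edge_at[OF v] .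
  show False
  proof (rule delete_edge[OF E(1,2) s, of 0 1 0 "-s"])
    show "\<bar>h w + - s\<bar> \<le> p w + 1" using local(2)[OF E(3)] s by auto
    show "nrm (c v + (0 - s)) \<le> nrm (c v) + 0 - 1" using good_nrm[OF s gd] by simp
    show "sum p V + 0 + 1 \<le> 4 + nrm (sum h V + 0 + - s)" using grow extremal_total by simp
  qed (use s local(2)[OF v] in auto)
qed

text \<open>Such an edge could be oriented so as to suit both ends: \<open>nrm\<close> then drops by
  one at each of them together with the degree.\<close>

lemma no_opposite_edge:
  assumes s: "s = 1 \<or> s = -1" and E: "E = add_mset {x, w} E1" "x \<noteq> w" and gd: "good s x" "good (-s) w"
  shows False
proof -
  have V: "x \<in> V" "w \<in> V" using g E by (auto simp: mgraph_add_mset)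
  have "nrm (c w + s) = nrm (c w) - 1" using good_nrm[of "-s" w] s gd(2) by auto
  then show False
    by (intro delete_edge[OF E s, of 0 0 0 0])
      (use s local(2)[OF V(1)] local(2)[OF V(2)] good_nrm[OF s gd(1)] total(1) in \<open>auto simp: nrm_mod\<close>)
qed

text \<open>Otherwise some pre-oriented edge at \<open>v\<close> contributes \<open>s\<close> to
  \<open>h v\<close> and can be forgotten: \<open>nrm (c v)\<close> drops by one together with the
  degree. \<open>V\<close>, \<open>E\<close> and \<open>b\<close> stay the same and only
  \<open>sum p V\<close> decreases, which is why it is a part of \<open>weight\<close>.\<close>

lemma pre_oriented_direction:
  assumes s: "s = 1 \<or> s = -1" and v: "v \<in> V" and gd: "good s v"
  shows "h v = - s * p v"
proof (rule ccontr)
  assume n: "\<not> ?thesis"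
  have l: "\<bar>h v\<bar> \<le> p v" "even (p v - h v)" using local[OF v] by auto
  have hp: "\<bar>h v - s\<bar> \<le> p v - 1" "1 \<le> p v" using abs_diff_sign[OF s n l] by auto
  let ?p = "\<lambda>u. p u + (-1) * of_bool (u = v)" and ?h = "\<lambda>u. h u + (-s) * of_bool (u = v)"
  have D: "sum ?p V = sum p V - 1" "sum ?h V = sum h V - s"
    using sum_indicator[OF fin] v by (simp_all only: sum.distrib) simp_all
  have dec: "nrm r \<le> nrm (r - s) + 1" for r using nrm_step[OF s, of r] by (simp split: if_splits)
  have inc: "nrm (r - s) \<le> nrm r + 1" for r using nrm_step[OF s, of r] by (simp split: if_splits)
  have "admissible V E b ?p ?h"
  proof (rule admissibleI[OF g ne zero local(1)])
    show "\<bar>?h u\<bar> \<le> ?p u" "even (?p u - ?h u)" if "u \<in> V" for u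
      using local[OF that] hp s by auto
    show "sum ?p V \<le> 4 + nrm (sum ?h V)" unfolding D using total(1) dec[of "sum h V"] by linarith
    fix A assume A: "A \<noteq> {}" "A \<subset> V"
    then have fA: "finite A" using fin finite_subset by blast
    have sc: "(\<Sum>u\<in>A. b u + ?h u) = sum c A + (-s) * of_bool (v \<in> A)"
      using sum_indicator(1)[OF fA, of s v] by (simp add: sum.distrib sum_subtractf)
    have d: "dg E ?p A = dg E p A - of_bool (v \<in> A)"
      using sum_indicator[OF fA] by (simp add: sum.distrib sum_subtractf dg_def)
    show "4 + nrm (\<Sum>u\<in>A. b u + ?h u) \<le> dg E ?p A"
      using singleton_or_nontrivial[OF A]
    proof
      assume "\<exists>u\<in>V. A = {u}"
      then obtain u where u: "u \<in> V" "A = {u}" by blast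
      then show ?thesis unfolding sc d using singleton_tight[OF u(1)] good_nrm[OF s gd] by auto
    next
      assume "2 \<le> card A"
      then show ?thesis unfolding sc d using nontrivial_cuts[OF A(2)] inc[of "sum c A"] by auto
    qed
  qed
  moreover have "weight V E ?p < weight V E p" using D hp(2) total(3) v local(4)
    member_le_sum[of v V p] fin by (simp add: weight_def)
  ultimately have "sol V E b" by (rule IH)
  then show False using no_sol by blast
qed

text \<open>All pre-oriented edges then have the same direction, and \<open>extremal_total\<close>
  gives their number.\<close>

lemma all_good_imp:
  assumes s: "s = 1 \<or> s = -1" and "\<And>v. v \<in> V \<Longrightarrow> good s v"
  shows "sum h V = - s * (4 + nrm (sum h V))"
proof -
  have "sum h V = (\<Sum>v\<in>V. - s * p v)" by (rule sum.cong) (use pre_oriented_direction[OF s] assms(2) in auto)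
  also have "\<dots> = - s * sum p V" by (rule sum_distrib_left[symmetric])
  finally show ?thesis unfolding extremal_total .
qed

lemma contradiction: False
proof -
  let ?T = "nrm (sum h V)"
  obtain v where v: "v \<in> V" using ne by auto
  have "0 \<le> ?T" "?T \<le> 3" by simp_all
  then consider "?T = 0" | "?T = 1 \<or> ?T = 2" | "?T = 3" by linarith
  then show False
  proof cases
    case 1
    \<comment> \<open>From residue 0 every step increases \<open>nrm\<close>, so neither sign can be
      good at \<open>v\<close>.\<close>
    then have "nrm (sum h V - s) = ?T + 1" if "s = 1 \<or> s = -1" for s
      using nrm_step[OF that, of "sum h V"] nrm_ge_0[of "sum h V - s"] by (auto split: if_splits)
    then show False using not_good_if_growing[OF _ v] good_or[OF v] by blast
  next
    case 2
    obtain s :: int where s: "s = 1 \<or> s = -1" and r: "(s * sum h V) mod 6 = ?T"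
      by (rule nrm_sign)
    have s': "-s = 1 \<or> -s = -1" using s by auto
    have "(- s * sum h V) mod 6 = 6 - ?T" using r 2 by (auto simp: zmod_zminus1_eq_if)
    then have "nrm (sum h V - (- s)) = ?T + 1" using nrm_step[OF s', of "sum h V"] 2 by auto
    then have ng: "\<not> good (- s) u" if "u \<in> V" for u using not_good_if_growing[OF s' that] by blast
    then have gd: "good s u" if "u \<in> V" for u using good_or[OF that] that s by fastforce
    \<comment> \<open>The pre-oriented edges all have one direction, so the total of
      \<open>h\<close> is 5 or 6 up to sign. Its \<open>nrm\<close> is 1 or 0 respectively, which
      excludes \<open>?T = 2\<close>.\<close>
    have "?T = nrm (4 + ?T)"
    proof -
      have "?T = nrm (- s * (4 + ?T))" using all_good_imp[OF s gd] by metis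
      then show ?thesis using nrm_mult_sign[OF s'] by metis
    qed
    then have T1: "?T = 1" using 2 by (elim disjE) (simp_all add: nrm_mod)
    have D: "sum p V = 5" "sum h V = - s * 5"
      using extremal_total all_good_imp[OF s gd] unfolding T1 by simp_all
    have "\<exists>x\<in>V. 1 \<le> p x"
    proof (rule ccontr)
      assume n: "\<not> ?thesis"
      have "p x \<le> 0" if "x \<in> V" for x
      proof -
        have "\<not> 1 \<le> p x" using n that by blast
        then show ?thesis by simp
      qed
      then have "sum p V \<le> 0" by (rule sum_nonpos)
      then show False using D by simp
    qed
    then obtain x where x: "x \<in> V" "1 \<le> p x" by blast
    obtain w E1 where E: "E = add_mset {x, w} E1" "x \<noteq> w" "w \<in> V" using edge_at[OF x(1)] .
    have hx: "h x = - s * p x" by (rule pre_oriented_direction[OF s x(1) gd[OF x(1)]])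
    \<comment> \<open>The residue of \<open>s * c x\<close> is 1 or 2, since 3 would be good for
      both signs; adding 4 gives 5 or 6, with \<open>nrm\<close> 1 or 0.\<close>
    have cx: "nrm (c x + 4 * s) \<le> nrm (c x)"
    proof -
      define r where "r = (s * c x) mod 6"
      have "(- (s * c x)) mod 6 = (if r = 0 then 0 else 6 - r)"
        unfolding r_def by (rule zmod_zminus1_eq_if)
      then have "r = 1 \<or> r = 2" using gd[OF x(1)] ng[OF x(1)] unfolding good_def r_def[symmetric]
        by (auto simp: algebra_simps split: if_splits)
      moreover have "nrm (c x + 4 * s) = nrm (r + 4)"
      proof -
        have "nrm (c x + 4 * s) = nrm (s * (c x + 4 * s))" using nrm_mult_sign[OF s] by metis
        also have "s * (c x + 4 * s) = s * c x + 4" using s by (auto simp: algebra_simps)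
        also have "nrm (s * c x + 4) = nrm (r + 4)"
          by (rule nrm_cong) (simp add: r_def minus_mod_eq_mult_div)
        finally show ?thesis .
      qed
      moreover have "nrm (c x) = nrm r"
      proof -
        have "nrm (c x) = nrm (s * c x)" using nrm_mult_sign[OF s] by metis
        also have "\<dots> = nrm r" by (rule nrm_cong) (simp add: r_def minus_mod_eq_mult_div)
        finally show ?thesis .
      qed
      ultimately show ?thesis by (auto simp: nrm_mod)
    qed
    \<comment> \<open>One pre-oriented edge at \<open>x\<close> is replaced by two edges of the opposite direction, which is
      the same modulo 3; this makes room for deleting an edge of the graph at \<open>x\<close>.\<close>
    show False
    proof (rule delete_edge[OF E(1,2) s', of 1 0 "3 * s" 0])
      show "\<bar>h x + 3 * s\<bar> \<le> p x + 1" using hx x(2) s by auto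
      show "\<bar>h w + 0\<bar> \<le> p w + 0" using local(2)[OF E(3)] by simp
      show "nrm (3 * s - - s) \<le> 1 + 1" "nrm (0 + - s) \<le> 1 + 0" "even (1 - 3 * s)"
        using s by (auto simp: nrm_mod)
      show "nrm (c x + (3 * s - - s)) \<le> nrm (c x) + 1 - 1" using cx by simp
      show "nrm (c w + (0 + - s)) \<le> nrm (c w) + 0 - 1" using good_nrm[OF s gd[OF E(3)]] by simp
      show "sum p V + 1 + 0 \<le> 4 + nrm (sum h V + 3 * s + 0)" using D s by (auto simp: nrm_mod)
    qed simp_all
  next
    case 3
    \<comment> \<open>Seven pre-oriented edges of one direction would give a total of residue 1 up
      to sign, not 3. So neither sign is good everywhere, and some edge joins vertices with opposite
      good signs.\<close>
    have not_all: "\<not> (\<forall>u\<in>V. good s u)" if s: "s = 1 \<or> s = -1" for s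
    proof
      assume "\<forall>u\<in>V. good s u"
      then have "sum h V = - s * 7" using all_good_imp[OF s] 3 by simp
      then show False using 3 s by (auto simp: nrm_mod)
    qed
    define A where "A = {u \<in> V. good 1 u}"
    have "A \<noteq> V" "A \<noteq> {}" using not_all[of 1] not_all[of "-1"] good_or by (auto simp: A_def)
    moreover have "A \<subseteq> V" by (auto simp: A_def)
    ultimately have "2 \<le> cut E A" using cut_ge_2(1)[of A] by blast
    then have "1 \<le> cut E A" by simp
    then obtain x w E1 where "x \<in> A" "w \<notin> A" "E = add_mset {x, w} E1" "x \<noteq> w" "w \<in> V"
      using cut_edge[OF g] by metis
    then show False using no_opposite_edge[of 1 x w E1] good_or[of w] by (auto simp: A_def)
  qed
qed

end

theorem admissible_imp_sol: "admissible V E b p h \<Longrightarrow> sol V E b"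
proof (induction "weight V E p" arbitrary: V E b p h rule: less_induct)
  case less
  show ?case
  proof (rule ccontr)
    assume "\<not> sol V E b"
    with less interpret minimal_instance V E b p h
      by unfold_locales blast+
    show False by (rule contradiction)
  qed
qed

section \<open>Graphs satisfying the partition condition for four edge-disjoint spanning trees\<close>

definition dense :: "'v set \<Rightarrow> 'v set multiset \<Rightarrow> bool" where
  "dense V E \<longleftrightarrow> mgraph V E \<and>
     (\<forall>P. partition_on V P \<longrightarrow> 8 * (int (card P) - 1) \<le> (\<Sum>A\<in>P. cut E A))"

lemma partition_sum:
  assumes "partition_on V P" "finite V"
  shows "(\<Sum>A\<in>P. sum f A) = sum f V"
proof -
  have "finite A" if "A \<in> P" for A
    using assms that finite_subset by (metis Union_upper partition_onD1)
  moreover have "\<forall>A\<in>P. \<forall>B\<in>P. A \<noteq> B \<longrightarrow> A \<inter> B = {}"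
    using partition_onD2[OF assms(1)] by (auto simp: disjoint_def)
  ultimately have "sum f (\<Union>P) = (\<Sum>A\<in>P. sum f A)"
    by (subst sum.Union_disjoint) auto
  then show ?thesis using partition_onD1[OF assms(1)] by simp
qed

lemma even_partition_cut:
  assumes g: "mgraph V E" and P: "partition_on V P"
  shows "even (\<Sum>A\<in>P. cut E A)"
proof -
  have fin: "finite V" using g mgraph_finite by blast
  have "even ((\<Sum>A\<in>P. cut E A) - (\<Sum>A\<in>P. \<Sum>v\<in>A. cut E {v}))"
  proof (rule even_sum_diff)
    fix A assume "A \<in> P"
    then have "finite A" using P fin finite_subset by (metis Union_upper partition_onD1)
    then show "even (cut E A - (\<Sum>v\<in>A. cut E {v}))" using cut_parity[OF g] by blast
  qed
  moreover have "even (\<Sum>v\<in>V. cut E {v})" using cut_parity[OF g fin] cut_whole[OF g] by simp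
  ultimately show ?thesis using partition_sum[OF P fin, of "\<lambda>v. cut E {v}"] by simp
qed

text \<open>A partition of the contracted graph pulls back along \<open>preim\<close> to a partition
  of \<open>V\<close> with equally many parts and the same cuts.\<close>

lemma dense_contract:
  assumes D: "dense V E" and A: "A \<subseteq> V" "a \<in> A"
  shows "dense (insert a (V - A)) (contract A a E)"
proof -
  let ?V = "insert a (V - A)"
  have g: "mgraph V E" using D by (simp add: dense_def)
  have "8 * (int (card P) - 1) \<le> (\<Sum>S\<in>P. cut (contract A a E) S)" if P: "partition_on ?V P" for P
  proof -
    have sub: "S \<subseteq> ?V" if "S \<in> P" for S using P that by (auto simp: partition_on_def)
    have inj: "inj_on (preim A a) P"
    proof (rule inj_onI)
      fix S T assume S: "S \<in> P" "T \<in> P" and eq: "preim A a S = preim A a T"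
      have "S = (preim A a S - A) \<union> (if a \<in> preim A a S then {a} else {})" if "S \<in> P" for S
        using sub[OF that] A by (auto simp: preim_def)
      then show "S = T" using S eq by metis
    qed
    have "partition_on V (preim A a ` P)"
    proof (rule partition_onI)
      show "\<Union> (preim A a ` P) = V"
      proof
        show "\<Union> (preim A a ` P) \<subseteq> V" using sub A by (fastforce simp: preim_def split: if_splits)
        show "V \<subseteq> \<Union> (preim A a ` P)"
        proof
          fix u assume u: "u \<in> V"
          have "(if u \<in> A then a else u) \<in> \<Union>P" using u partition_onD1[OF P] by auto
          then obtain S where "S \<in> P" "(if u \<in> A then a else u) \<in> S" by blast
          then have "u \<in> preim A a S" using A by (auto simp: preim_def split: if_splits)
          then show "u \<in> \<Union> (preim A a ` P)" using \<open>S \<in> P\<close> by blast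
        qed
      qed
      show "disjnt X Y" if XY: "X \<in> preim A a ` P" "Y \<in> preim A a ` P" "X \<noteq> Y" for X Y
      proof -
        obtain S T where S: "S \<in> P" "X = preim A a S" and T: "T \<in> P" "Y = preim A a T" using XY by blast
        then have "S \<noteq> T" using XY by blast
        then have "S \<inter> T = {}" using partition_onD2[OF P] S T by (auto simp: disjoint_def)
        then show ?thesis using sub[OF S(1)] sub[OF T(1)] S T by (auto simp: preim_def disjnt_def)
      qed
      show "{} \<notin> preim A a ` P"
      proof
        assume "{} \<in> preim A a ` P"
        then obtain S where S: "S \<in> P" "preim A a S = {}" by force
        moreover have "S \<noteq> {}" using P S(1) by (auto simp: partition_on_def)
        ultimately show False using A by (auto simp: preim_def split: if_splits)
      qed
    qed
    then have "8 * (int (card (preim A a ` P)) - 1) \<le> (\<Sum>S\<in>preim A a ` P. cut E S)"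
      using D by (simp add: dense_def)
    moreover have "(\<Sum>S\<in>preim A a ` P. cut E S) = (\<Sum>S\<in>P. cut (contract A a E) S)"
      unfolding sum.reindex[OF inj] o_def
      by (rule sum.cong) (use cut_contract_preim[OF g A(1) sub A(2)] in auto)
    ultimately show ?thesis using card_image[OF inj] by simp
  qed
  then show ?thesis using contract_mgraph[OF g A] by (simp add: dense_def)
qed

lemma partition_refine:
  assumes P: "partition_on V P" and A: "A \<in> P" and Q: "partition_on A Q"
  shows "partition_on V ((P - {A}) \<union> Q)" and "(P - {A}) \<inter> Q = {}"
proof -
  have dA: "B \<inter> A = {}" if "B \<in> P - {A}" for B
    using partition_onD2[OF P] A that by (auto simp: disjoint_def)
  have QA: "C \<subseteq> A" "C \<noteq> {}" if "C \<in> Q" for C using Q that by (auto simp: partition_on_def)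
  show "partition_on V ((P - {A}) \<union> Q)"
  proof (rule partition_onI)
    show "\<Union> (P - {A} \<union> Q) = V" using A P Q unfolding partition_on_def by blast
    show "{} \<notin> P - {A} \<union> Q" using P QA by (auto simp: partition_on_def)
    fix X Y assume X: "X \<in> P - {A} \<union> Q" and Y: "Y \<in> P - {A} \<union> Q" and "X \<noteq> Y"
    have "X \<inter> Y = {}"
    proof (cases "X \<in> Q")
      case True
      show ?thesis
      proof (cases "Y \<in> Q")
        case True
        then show ?thesis using \<open>X \<in> Q\<close> \<open>X \<noteq> Y\<close> disjointD[OF partition_onD2[OF Q]] by blast
      next
        case False
        then have "Y \<inter> A = {}" using Y dA by blast
        then show ?thesis using QA(1)[OF \<open>X \<in> Q\<close>] by blast
      qed
    next
      case False
      then have XP: "X \<in> P - {A}" using X by blast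
      show ?thesis
      proof (cases "Y \<in> Q")
        case True
        then show ?thesis using QA(1)[OF True] dA[OF XP] by blast
      next
        case False
        then have "Y \<in> P" using Y by blast
        then show ?thesis using XP \<open>X \<noteq> Y\<close> disjointD[OF partition_onD2[OF P]] by blast
      qed
    qed
    then show "disjnt X Y" by (simp add: disjnt_def)
  qed
  have "C \<notin> Q" if "C \<in> P - {A}" for C
    using dA[OF that] QA(1)[of C] QA(2)[of C] by (metis inf.absorb1)
  then show "(P - {A}) \<inter> Q = {}" by blast
qed

text \<open>The edges leaving \<open>A\<close> are shared out among the parts in \<open>Q\<close>;
  the only new contributions come from edges inside \<open>A\<close>.\<close>

lemma cut_refine:
  assumes g: "mgraph V E" and P: "partition_on V P" and A: "A \<in> P" and Q: "partition_on A Q"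
  shows "(\<Sum>B\<in>(P - {A}) \<union> Q. cut E B) = (\<Sum>B\<in>P. cut E B) + (\<Sum>B\<in>Q. cut (filter_mset (\<lambda>e. e \<subseteq> A) E) B)"
    and "int (card ((P - {A}) \<union> Q)) = int (card P) - 1 + int (card Q)"
proof -
  have fin: "finite V" using g mgraph_finite by blast
  have fP: "finite P" using P fin by (rule finite_elements[rotated])
  have AV: "A \<subseteq> V" using P A by (auto simp: partition_on_def)
  then have fA: "finite A" using fin finite_subset by blast
  have fQ: "finite Q" using Q fA by (rule finite_elements[rotated])
  let ?I = "filter_mset (\<lambda>e. e \<subseteq> A) E" and ?O = "filter_mset (\<lambda>e. \<not> e \<subseteq> A) E"
  have sp: "cut E B = cut ?I B + cut ?O B" for B by (rule cut_filter_split)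
  have gI: "mgraph A ?I" using g fA by (auto simp: mgraph_def)
  have "cut ?O B = (\<Sum>v\<in>B. cut ?O {v})" if "B \<subseteq> A" for B by (rule cut_crossing[OF g that fA])
  then have "(\<Sum>B\<in>Q. cut ?O B) = (\<Sum>B\<in>Q. \<Sum>v\<in>B. cut ?O {v})"
    by (intro sum.cong) (use Q in \<open>auto simp: partition_on_def\<close>)
  also have "\<dots> = cut ?O A" using partition_sum[OF Q fA] cut_crossing[OF g order_refl fA] by metis
  also have "\<dots> = cut E A" using sp[of A] cut_whole[OF gI] by simp
  finally have O: "(\<Sum>B\<in>Q. cut ?O B) = cut E A" .
  have "(\<Sum>B\<in>Q. cut E B) = (\<Sum>B\<in>Q. cut ?I B + cut ?O B)" by (rule sum.cong) (simp_all add: sp[symmetric])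
  then have "(\<Sum>B\<in>Q. cut E B) = (\<Sum>B\<in>Q. cut ?I B) + cut E A" unfolding sum.distrib O .
  moreover have "(\<Sum>B\<in>(P - {A}) \<union> Q. cut E B) = (\<Sum>B\<in>P - {A}. cut E B) + (\<Sum>B\<in>Q. cut E B)"
    using fP fQ partition_refine(2)[OF P A Q] by (intro sum.union_disjoint) auto
  moreover have "(\<Sum>B\<in>P. cut E B) = cut E A + (\<Sum>B\<in>P - {A}. cut E B)" by (rule sum.remove[OF fP A])
  ultimately show "(\<Sum>B\<in>(P - {A}) \<union> Q. cut E B) = (\<Sum>B\<in>P. cut E B) + (\<Sum>B\<in>Q. cut ?I B)" by linarith
  have "1 \<le> card P" using card_mono[OF fP, of "{A}"] A by simp
  then show "int (card ((P - {A}) \<union> Q)) = int (card P) - 1 + int (card Q)"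
    using card_Un_disjoint[of "P - {A}" Q] fP fQ partition_refine(2)[OF P A Q] card_Diff_singleton[OF A] by simp
qed

lemma partition_two:
  assumes "A \<noteq> {}" "A \<subset> V"
  shows "partition_on V {A, V - A}"
  using assms by (auto simp: partition_on_def disjoint_def)

section \<open>A minimal dense counterexample\<close>

locale minimal_dense =
  fixes V :: "'v set" and E b
  assumes D: "dense V E" and ne: "V \<noteq> {}" and par: "\<And>v. v \<in> V \<Longrightarrow> even (b v - cut E {v})"
    and zero: "6 dvd sum b V"
    and IH: "\<And>V' E' b'. dense V' E' \<Longrightarrow> V' \<noteq> {} \<Longrightarrow> (\<And>v. v \<in> V' \<Longrightarrow> even (b' v - cut E' {v})) \<Longrightarrow>
      6 dvd sum b' V' \<Longrightarrow> card V' + size E' < card V + size E \<Longrightarrow> sol V' (E' :: 'v set multiset) b'"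
    and no_sol: "\<not> sol V E b"
begin

lemma g: "mgraph V E" and fin: "finite V"
  using D by (auto simp: dense_def mgraph_def)

lemma contracted:
  assumes A: "A \<subseteq> V" "a \<in> A" "2 \<le> card A"
  shows "sol (insert a (V - A)) (contract A a E) (csum A a b)"
proof (rule IH[OF dense_contract[OF D A(1,2)]])
  show "even (csum A a b v - cut (contract A a E) {v})" if "v \<in> insert a (V - A)" for v
    by (rule csum_parity[OF g A(1,2) par that])
  have "preim A a (insert a (V - A)) = V" using A by (auto simp: preim_def)
  then show "6 dvd sum (csum A a b) (insert a (V - A))"
    using sum_csum[OF fin A(1) order_refl A(2)] zero by simp
  have "card (insert a (V - A)) = Suc (card (V - A))" using A fin by simp
  also have "card (V - A) = card V - card A" using A fin by (simp add: card_Diff_subset finite_subset)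
  finally show "card (insert a (V - A)) + size (contract A a E) < card V + size E"
    using A card_mono[OF fin A(1)] size_contract[of A a E] by linarith
qed auto

lemma induced_not_dense:
  assumes A: "A \<subset> V" "2 \<le> card A"
  shows "\<not> dense A (filter_mset (\<lambda>e. e \<subseteq> A) E)"
proof
  assume d: "dense A (filter_mset (\<lambda>e. e \<subseteq> A) E)"
  have "A \<noteq> {}" using A by auto
  then obtain a where a: "a \<in> A" by blast
  have AV: "A \<subseteq> V" using A by blast
  have "sol V E b"
  proof (rule sol_contract[OF g AV a par contracted[OF AV a A(2)]])
    show "csum A a b a = sum b A" by (simp add: csum_def)
    show "csum A a b v = b v" if "v \<in> V - A" for v using that a by (auto simp: csum_def)
    show "sol A (filter_mset (\<lambda>e. e \<subseteq> A) E) b2"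
      if "\<And>v. v \<in> A \<Longrightarrow> even (b2 v - cut (filter_mset (\<lambda>e. e \<subseteq> A) E) {v})" "6 dvd sum b2 A" for b2
      using IH[OF d \<open>A \<noteq> {}\<close> that] psubset_card_mono[OF fin A(1)]
        size_filter_mset_lesseq[of "\<lambda>e. e \<subseteq> A" E] by linarith
  qed
  then show False using no_sol by blast
qed

lemma simple:
  assumes "u \<noteq> v" "E = add_mset {u, v} (add_mset {u, v} E')"
  shows False
proof -
  have "{u, v} \<subseteq> V" using g assms(2) by (auto simp: mgraph_def)
  then have "sol (insert u (V - {u, v})) (contract {u, v} u E) (csum {u, v} u b)"
    by (rule contracted) (use assms(1) in auto)
  then have "sol V E b" using sol_contract_parallel[OF g assms par] by blast
  then show False using no_sol by blast
qed

lemma deficient_partition: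
  assumes A: "A \<subset> V" "2 \<le> card A"
  obtains Q where "partition_on A Q"
    "(\<Sum>B\<in>Q. cut (filter_mset (\<lambda>e. e \<subseteq> A) E) B) \<le> 8 * (int (card Q) - 1) - 2"
proof -
  let ?I = "filter_mset (\<lambda>e. e \<subseteq> A) E"
  have gI: "mgraph A ?I" using g A finite_subset by (auto simp: mgraph_def)
  then obtain Q where Q: "partition_on A Q" "\<not> 8 * (int (card Q) - 1) \<le> (\<Sum>B\<in>Q. cut ?I B)"
    using induced_not_dense[OF A] by (auto simp: dense_def)
  have "even (\<Sum>B\<in>Q. cut ?I B)" by (rule even_partition_cut[OF gI Q(1)])
  then have "(\<Sum>B\<in>Q. cut ?I B) \<le> 8 * (int (card Q) - 1) - 2" using Q(2) by presburger
  then show ?thesis using that Q(1) by blast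
qed

lemma dense_partition: "partition_on V P \<Longrightarrow> 8 * (int (card P) - 1) \<le> (\<Sum>A\<in>P. cut E A)"
  using D by (simp add: dense_def)

text \<open>The graph induced on \<open>A\<close> is not dense, so some partition \<open>Q\<close>
  of \<open>A\<close> misses its bound, by at least 2. The refinement of \<open>P\<close> by
  \<open>Q\<close> still satisfies the bound, so \<open>P\<close> has to make up for this
  deficit.\<close>

lemma nontrivial_partition:
  assumes P: "partition_on V P" and A: "A \<in> P" "2 \<le> card A" "A \<noteq> V"
  shows "8 * (int (card P) - 1) + 2 \<le> (\<Sum>A\<in>P. cut E A)"
proof -
  have "A \<subset> V" using P A by (auto simp: partition_on_def)
  then obtain Q where Q: "partition_on A Q"
    "(\<Sum>B\<in>Q. cut (filter_mset (\<lambda>e. e \<subseteq> A) E) B) \<le> 8 * (int (card Q) - 1) - 2"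
    using deficient_partition A(2) by metis
  have "8 * (int (card ((P - {A}) \<union> Q)) - 1) \<le> (\<Sum>B\<in>(P - {A}) \<union> Q. cut E B)"
    by (rule dense_partition[OF partition_refine(1)[OF P A(1) Q(1)]])
  then show ?thesis using cut_refine[OF g P A(1) Q(1)] Q(2) by simp
qed

lemma two_parts:
  assumes "A \<noteq> {}" "A \<subset> V"
  shows "card {A, V - A} = 2" "(\<Sum>B\<in>{A, V - A}. cut E B) = 2 * cut E A"
proof -
  have "A \<noteq> V - A" using assms by auto
  then show "card {A, V - A} = 2" "(\<Sum>B\<in>{A, V - A}. cut E B) = 2 * cut E A"
    using cut_compl[OF g] assms by auto
qed

lemma cut_ge_4: assumes "A \<noteq> {}" "A \<subset> V" shows "4 \<le> cut E A"
  using dense_partition[OF partition_two[OF assms]] two_parts[OF assms] by simp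

lemma cut_ge_5: assumes "A \<noteq> {}" "A \<subset> V" "2 \<le> card (V - A)" shows "5 \<le> cut E A"
proof -
  have "V - A \<noteq> V" using assms by auto
  then show ?thesis
    using nontrivial_partition[OF partition_two[OF assms(1,2)] _ assms(3)] two_parts[OF assms(1,2)] by simp
qed

text \<open>Refining \<open>A\<close> leaves \<open>V - A\<close> as a nontrivial part, so the gain
  of 2 is available on both sides of the cut.\<close>

lemma cut_ge_6: assumes A: "A \<subset> V" "2 \<le> card A" "2 \<le> card (V - A)" shows "6 \<le> cut E A"
proof -
  have ne': "A \<noteq> {}" using A by auto
  let ?P = "{A, V - A}"
  have P: "partition_on V ?P" by (rule partition_two[OF ne' A(1)])
  obtain Q where Q: "partition_on A Q"
    "(\<Sum>B\<in>Q. cut (filter_mset (\<lambda>e. e \<subseteq> A) E) B) \<le> 8 * (int (card Q) - 1) - 2"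
    using deficient_partition[OF A(1,2)] by metis
  have "V - A \<in> ?P - {A} \<union> Q" "V - A \<noteq> V" using ne' A(1) by auto
  then have "8 * (int (card (?P - {A} \<union> Q)) - 1) + 2 \<le> (\<Sum>B\<in>?P - {A} \<union> Q. cut E B)"
    using nontrivial_partition[OF partition_refine(1)[OF P _ Q(1)] _ A(3)] by blast
  moreover have "A \<in> ?P" by simp
  ultimately have "8 * (int (card ?P) - 1 + int (card Q) - 1) + 2
     \<le> (\<Sum>B\<in>?P. cut E B) + (\<Sum>B\<in>Q. cut (filter_mset (\<lambda>e. e \<subseteq> A) E) B)"
    using cut_refine[OF g P _ Q(1)] by metis
  then show ?thesis using two_parts[OF ne' A(1)] Q(2) by simp
qed

lemma two_edges:
  assumes "v \<in> V" "V \<noteq> {v}"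
  obtains x y E' where "E = add_mset {v, x} (add_mset {v, y} E')"
    "v \<noteq> x" "v \<noteq> y" "x \<noteq> y" "x \<in> V" "y \<in> V"
proof -
  have 4: "4 \<le> cut E {v}" using cut_ge_4[of "{v}"] assms by auto
  then have "1 \<le> cut E {v}" by simp
  from cut_edge[OF g this] obtain x E1 where x: "E = add_mset {v, x} E1" "v \<noteq> x" "x \<in> V"
    by (metis singletonD)
  have 3: "1 \<le> cut E1 {v}" using 4 x by (simp add: crosses_pair)
  have "mgraph V E1" using g x by (simp add: mgraph_add_mset)
  from cut_edge[OF this 3] obtain y E2 where y: "E1 = add_mset {v, y} E2" "v \<noteq> y" "y \<in> V"
    by (metis singletonD)
  have "x \<noteq> y" using simple[of v x E2] x y by auto
  then show ?thesis using that x y by blast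
qed

lemma card_ge_3: "3 \<le> card V"
proof (rule ccontr)
  assume n: "\<not> ?thesis"
  obtain v where v: "v \<in> V" using ne by auto
  show False
  proof (cases "V = {v}")
    case True
    then have "sol V E b" using sol_single_vertex[of v E b] g zero by simp
    then show False using no_sol by blast
  next
    case False
    obtain x y E' where xy: "v \<noteq> x" "v \<noteq> y" "x \<noteq> y" "x \<in> V" "y \<in> V"
      using two_edges[OF v False] by metis
    then have "card {v, x, y} = 3" by auto
    then have "3 \<le> card V" using card_mono[OF fin, of "{v, x, y}"] v xy by auto
    then show False using n by blast
  qed
qed

text \<open>Three edges directed away from \<open>v\<close> supply the net out-degree 3, the lifted
  pair supplies 0. For density, dropping the part \<open>{v}\<close> lowers the bound by 8 and the
  deleted edges cost 10; the missing 2 come from a nontrivial part or, if all parts are single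
  vertices, from the lifted edge, which joins two of them.\<close>

lemma no_odd_vertex:
  assumes v: "v \<in> V" and d5: "cut E {v} = 5" and b3: "6 dvd b v - 3"
  shows False
proof -
  have nV: "V \<noteq> {v}" using card_ge_3 by auto
  obtain x y E0 where E: "E = add_mset {v, x} (add_mset {v, y} E0)"
    and d: "v \<noteq> x" "v \<noteq> y" "x \<noteq> y" and xy: "x \<in> V" "y \<in> V"
    using two_edges[OF v nV] by metis
  have g0: "mgraph V E0" and c0: "cut E0 {v} = 3" using g d5 d by (auto simp: E mgraph_add_mset crosses_pair)
  obtain w1 E1 where w1: "E0 = add_mset {v, w1} E1" "v \<noteq> w1" "w1 \<in> V"
    using cut_edge[OF g0, of "{v}"] c0 by (metis one_le_numeral singletonD)
  have g1: "mgraph V E1" and c1: "cut E1 {v} = 2" using g0 c0 w1 by (auto simp: mgraph_add_mset crosses_pair)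
  obtain w2 E2 where w2: "E1 = add_mset {v, w2} E2" "v \<noteq> w2" "w2 \<in> V"
    using cut_edge[OF g1, of "{v}"] c1 by (metis one_le_numeral singletonD)
  have g2: "mgraph V E2" and c2: "cut E2 {v} = 1" using g1 c1 w2 by (auto simp: mgraph_add_mset crosses_pair)
  obtain w3 E3 where w3: "E2 = add_mset {v, w3} E3" "v \<noteq> w3" "w3 \<in> V"
    using cut_edge[OF g2, of "{v}"] c2 by (metis order_refl singletonD)
  have g3: "mgraph V E3" and c3: "cut E3 {v} = 0" using g2 c2 w3 by (auto simp: mgraph_add_mset crosses_pair)
  have Eq: "E = add_mset {v, x} (add_mset {v, y} (add_mset {v, w1} (add_mset {v, w2} (add_mset {v, w3} E3))))"
    using E w1 w2 w3 by simp
  let ?V = "V - {v}" and ?E = "add_mset {x, y} E3"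
  have gV: "mgraph ?V E3" by (rule mgraph_remove_isolated[OF g3 c3])
  then have gE: "mgraph ?V ?E" using d xy by (simp add: mgraph_add_mset)
  have finV: "finite ?V" using fin by simp
  let ?b = "\<lambda>u. b u + of_bool (u = w1) + of_bool (u = w2) + of_bool (u = w3) - 3 * of_bool (u = v)"
  have "dense ?V ?E"
    unfolding dense_def
  proof (intro conjI gE allI impI)
    fix Q assume Q: "partition_on ?V Q"
    have fQ: "finite Q" using Q finV by (rule finite_elements[rotated])
    have QA: "A \<subseteq> ?V" "A \<noteq> {}" if "A \<in> Q" for A using Q that by (auto simp: partition_on_def)
    have one: "(\<Sum>A\<in>Q. of_bool (u \<in> A)) = (1 :: int)" if "u \<in> ?V" for u
    proof -
      have "(\<Sum>A\<in>Q. of_bool (u \<in> A)) = (\<Sum>A\<in>Q. \<Sum>t\<in>A. of_bool (t = u) :: int)"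
      proof (rule sum.cong)
        fix A assume "A \<in> Q"
        then have "finite A" using QA finV finite_subset by blast
        then show "of_bool (u \<in> A) = (\<Sum>t\<in>A. of_bool (t = u) :: int)" by (simp add: sum_indicator)
      qed simp
      also have "\<dots> = 1" unfolding partition_sum[OF Q finV] using that finV by (simp add: sum_indicator)
      finally show ?thesis .
    qed
    let ?P = "insert {v} Q"
    have P: "partition_on V ?P"
    proof -
      have "V = insert v ?V" using v by blast
      then show ?thesis using Q unfolding partition_on_def disjoint_def by auto
    qed
    have vQ: "{v} \<notin> Q" using QA by blast
    have "(\<Sum>A\<in>Q. cut E A) = (\<Sum>A\<in>Q. cut E3 A + of_bool (x \<in> A) + of_bool (y \<in> A) + of_bool (w1 \<in> A)
        + of_bool (w2 \<in> A) + of_bool (w3 \<in> A))"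
      by (rule sum.cong) (use QA in \<open>auto simp: Eq crosses_pair\<close>)
    also have "\<dots> = (\<Sum>A\<in>Q. cut E3 A) + 5"
      using one[of x] one[of y] one[of w1] one[of w2] one[of w3] xy d w1 w2 w3 by (simp add: sum.distrib)
    finally have sP: "(\<Sum>A\<in>?P. cut E A) = (\<Sum>A\<in>Q. cut E3 A) + 10" using fQ vQ d5 by simp
    have cP: "card ?P = card Q + 1" using fQ vQ by simp
    have sE: "(\<Sum>A\<in>Q. cut ?E A) = (\<Sum>A\<in>Q. of_bool (crosses {x, y} A)) + (\<Sum>A\<in>Q. cut E3 A)"
      by (simp add: sum.distrib)
    show "8 * (int (card Q) - 1) \<le> (\<Sum>A\<in>Q. cut ?E A)"
    proof (cases "\<exists>A\<in>Q. 2 \<le> card A")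
      case True
      then obtain A where A: "A \<in> Q" "2 \<le> card A" by blast
      then have "A \<noteq> V" using QA v by blast
      then have "8 * (int (card ?P) - 1) + 2 \<le> (\<Sum>A\<in>?P. cut E A)"
        using nontrivial_partition[OF P _ A(2)] A(1) by blast
      moreover have "0 \<le> (\<Sum>A\<in>Q. of_bool (crosses {x, y} A) :: int)" by (rule sum_nonneg) simp
      ultimately show ?thesis using sP cP sE by simp
    next
      case False
      have sing: "{u} \<in> Q" if "u \<in> ?V" for u
      proof -
        have "u \<in> \<Union>Q" using that unfolding partition_onD1[OF Q] .
        then obtain A where A: "A \<in> Q" "u \<in> A" by blast
        then have "finite A" "card A < 2" using QA finV finite_subset False by (blast, auto)
        then have "card A = 1" using A(2) card_gt_0_iff[of A] by (cases "card A") auto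
        then have "A = {u}" using A(2) card_1_singletonE by (metis singletonD)
        then show ?thesis using A by simp
      qed
      have "{{x}, {y}} \<subseteq> Q" using sing xy d by auto
      then have "(\<Sum>A\<in>{{x}, {y}}. of_bool (crosses {x, y} A) :: int) \<le> (\<Sum>A\<in>Q. of_bool (crosses {x, y} A))"
        using fQ by (intro sum_mono2) auto
      then have "2 \<le> (\<Sum>A\<in>Q. of_bool (crosses {x, y} A) :: int)" using d by (simp add: crosses_pair)
      moreover have "8 * (int (card ?P) - 1) \<le> (\<Sum>A\<in>?P. cut E A)" by (rule dense_partition[OF P])
      ultimately show ?thesis using sP cP sE by simp
    qed
  qed
  then have "sol ?V ?E ?b"
  proof (rule IH)
    show "?V \<noteq> {}" using nV v by auto
    show "even (?b u - cut ?E {u})" if "u \<in> ?V" for u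
      using par[of u] that d w1(2) w2(2) w3(2) unfolding Eq by (auto simp: crosses_pair split: if_splits)
    have "sum ?b ?V = sum b ?V + 3"
      using sum_indicator[OF finV] w1 w2 w3 by (simp add: sum.distrib sum_subtractf)
    also have "\<dots> = sum b V - (b v - 3)" using sum.remove[OF fin v, of b] by simp
    finally show "6 dvd sum ?b ?V" using zero b3 by simp
    show "card ?V + size ?E < card V + size E"
      using card_Diff_singleton[OF v] card_ge_3 unfolding Eq by simp
  qed
  then have "sol V ?E ?b"
  proof (rule sol_extend[OF _ gE])
    fix u assume "u \<in> V - ?V"
    then have "u = v" by auto
    then show "6 dvd ?b u" using b3 w1 w2 w3 by simp
  qed
  then have "sol V (add_mset {x, v} (add_mset {v, y} E3)) ?b" by (rule sol_lift)
  then have "sol V (add_mset {x, v} (add_mset {v, y} E3))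
     (\<lambda>u. (b u + of_bool (u = w1) + of_bool (u = w2) - 2 * of_bool (u = v)) - 1 * of_bool (u = v) + 1 * of_bool (u = w3))"
    by (rule sol_cong) (auto simp: algebra_simps)
  then have "sol V (add_mset {v, w3} (add_mset {x, v} (add_mset {v, y} E3)))
     (\<lambda>u. b u + of_bool (u = w1) + of_bool (u = w2) - 2 * of_bool (u = v))" by (rule sol_delete) simp
  then have "sol V (add_mset {v, w3} (add_mset {x, v} (add_mset {v, y} E3)))
     (\<lambda>u. (b u + of_bool (u = w1) - 1 * of_bool (u = v)) - 1 * of_bool (u = v) + 1 * of_bool (u = w2))"
    by (rule sol_cong) (auto simp: algebra_simps)
  then have "sol V (add_mset {v, w2} (add_mset {v, w3} (add_mset {x, v} (add_mset {v, y} E3))))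
     (\<lambda>u. b u + of_bool (u = w1) - 1 * of_bool (u = v))" by (rule sol_delete) simp
  then have "sol V (add_mset {v, w2} (add_mset {v, w3} (add_mset {x, v} (add_mset {v, y} E3))))
     (\<lambda>u. b u - 1 * of_bool (u = v) + 1 * of_bool (u = w1))"
    by (rule sol_cong) (auto simp: algebra_simps)
  then have "sol V (add_mset {v, w1} (add_mset {v, w2} (add_mset {v, w3} (add_mset {x, v} (add_mset {v, y} E3))))) b"
    by (rule sol_delete) simp
  moreover have "add_mset {v, w1} (add_mset {v, w2} (add_mset {v, w3} (add_mset {x, v} (add_mset {v, y} E3)))) = E"
    unfolding Eq by (simp add: add_mset_commute insert_commute)
  ultimately show False using no_sol by simp
qed

lemma contradiction: False
proof -
  have parA: "even (cut E A - sum b A)" if "A \<subseteq> V" for A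
  proof -
    have fA: "finite A" using that fin finite_subset by blast
    have "even (sum b A - (\<Sum>v\<in>A. cut E {v}))" by (rule even_sum_diff) (use par that in blast)
    then show ?thesis using cut_parity[OF g fA] by simp
  qed
  have vertex: "4 + nrm (b v) \<le> cut E {v}" if v: "v \<in> V" for v
  proof -
    have "{v} \<subset> V" "2 \<le> card (V - {v})" using v card_ge_3 fin by auto
    then have 5: "5 \<le> cut E {v}" using cut_ge_5 by simp
    have e: "even (cut E {v} - nrm (b v))" using par[OF v] nrm_parity[of "b v"] by simp
    \<comment> \<open>Degree 5 allows only the odd residues with \<open>nrm\<close> 1 and 3, and 1
      meets the bound exactly; from degree 6 on, parity alone gives it.\<close>
    have "nrm (b v) \<noteq> 3" if "cut E {v} = 5"
    proof
      assume n: "nrm (b v) = 3"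
      obtain k where "b v = 6 * k + 3 \<or> b v = 6 * k - 3" using nrm_residue[of "b v"] n by auto
      then have "6 dvd b v - 3" by presburger
      then show False using no_odd_vertex[OF v \<open>cut E {v} = 5\<close>] by blast
    qed
    then show ?thesis using 5 e nrm_le_3[of "b v"] nrm_ge_0[of "b v"] by presburger
  qed
  have "admissible V E b (\<lambda>_. 0) (\<lambda>_. 0)"
  proof (rule admissibleI[OF g ne zero par])
    fix A assume A: "A \<noteq> {}" "A \<subset> V"
    then have AV: "A \<subseteq> V" and fA: "finite A" using fin finite_subset by auto
    have cc: "cut E (V - A) = cut E A" by (rule cut_compl[OF g AV])
    have "card A \<noteq> 0" "card (V - A) \<noteq> 0" using A fA fin by auto
    then consider "card A = 1" | "card (V - A) = 1" | "2 \<le> card A" "2 \<le> card (V - A)" by linarith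
    then have "4 + nrm (sum b A) \<le> cut E A"
    proof cases
      case 1
      then obtain v where v: "A = {v}" by (rule card_1_singletonE)
      then have "v \<in> V" using A by blast
      then show ?thesis using vertex[of v] v by simp
    next
      case 2
      then obtain v where v: "V - A = {v}" by (rule card_1_singletonE)
      have "sum b V = sum b {v} + sum b A" using sum.subset_diff[OF AV fin, of b] v by simp
      \<comment> \<open>The total is divisible by 6, so complementary sets have opposite residues
        and the same \<open>nrm\<close>.\<close>
      then have "6 dvd sum b A - (- b v)" using zero by (simp add: add.commute)
      then have "nrm (sum b A) = nrm (b v)" using nrm_cong nrm_minus by metis
      then show ?thesis using vertex[of v] v cc by auto
    next
      case 3
      then have "6 \<le> cut E A" using cut_ge_6 A by blast
      moreover have "even (cut E A - nrm (sum b A))" using parA[OF AV] nrm_parity[of "sum b A"] by simp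
      ultimately show ?thesis using nrm_le_3[of "sum b A"] by presburger
    qed
    then show "4 + nrm (\<Sum>v\<in>A. b v + 0) \<le> dg E (\<lambda>_. 0) A" by (simp add: dg_def)
  qed auto
  then have "sol V E b" by (rule admissible_imp_sol)
  then show False using no_sol by blast
qed

end

theorem dense_imp_sol:
  assumes "dense V E" "V \<noteq> {}" "\<And>v. v \<in> V \<Longrightarrow> even (b v - cut E {v})" "6 dvd sum b V"
  shows "sol V E b"
  using assms
proof (induction "card V + size E" arbitrary: V E b rule: less_induct)
  case less
  show ?case
  proof (rule ccontr)
    assume "\<not> sol V E b"
    with less interpret minimal_dense V E b
      by unfold_locales blast+
    show False by (rule contradiction)
  qed
qed

section \<open>Essentially 23-edge-connected graphs\<close>

lemma weighted_cut_sum: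
  fixes f :: "'v set \<Rightarrow> real"
  assumes "finite P"
  shows "(\<Sum>A\<in>P. f A * of_int (cut E A)) = (\<Sum>e\<in>#E. \<Sum>A\<in>P. f A * of_bool (crosses e A))"
  by (induction E) (simp_all add: distrib_left sum.distrib)

text \<open>The edge crosses either no part or exactly the two parts that contain its ends.\<close>

lemma weighted_edge_nonneg:
  fixes f :: "'v set \<Rightarrow> real"
  assumes P: "partition_on V P" "finite P" and xy: "x \<in> V" "y \<in> V"
    and pos: "\<And>A B. A \<in> P \<Longrightarrow> B \<in> P \<Longrightarrow> A \<noteq> B \<Longrightarrow> x \<in> A \<Longrightarrow> y \<in> B \<Longrightarrow> 0 \<le> f A + f B"
  shows "0 \<le> (\<Sum>A\<in>P. f A * of_bool (crosses {x, y} A))"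
proof -
  have "x \<in> \<Union>P" "y \<in> \<Union>P" using xy unfolding partition_onD1[OF P(1)] .
  then obtain A B where A: "A \<in> P" "x \<in> A" and B: "B \<in> P" "y \<in> B" by blast
  have uniq: "C = A" if "C \<in> P" "x \<in> C" for C
    using disjointD[OF partition_onD2[OF P(1)] that(1) A(1)] that(2) A(2) by blast
  have uniq': "C = B" if "C \<in> P" "y \<in> C" for C
    using disjointD[OF partition_onD2[OF P(1)] that(1) B(1)] that(2) B(2) by blast
  have iff: "x \<in> C \<longleftrightarrow> C = A" "y \<in> C \<longleftrightarrow> C = B" if "C \<in> P" for C
    using uniq[OF that] uniq'[OF that] A(2) B(2) by blast+
  show ?thesis
  proof (cases "A = B")
    case True
    then have "(\<Sum>C\<in>P. f C * of_bool (crosses {x, y} C)) = 0"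
      using iff by (intro sum.neutral) (simp add: crosses_pair)
    then show ?thesis by simp
  next
    case False
    have "(\<Sum>C\<in>P. f C * of_bool (crosses {x, y} C)) = (\<Sum>C\<in>{A, B}. f C)"
    proof (rule sum.mono_neutral_cong_right[OF P(2)])
      show "{A, B} \<subseteq> P" using A B by blast
      show "\<forall>C\<in>P - {A, B}. f C * of_bool (crosses {x, y} C) = 0"
        using iff by (simp add: crosses_pair)
      show "f C * of_bool (crosses {x, y} C) = f C" if "C \<in> {A, B}" for C
        using that False iff[of C] A(1) B(1) by (auto simp: crosses_pair)
    qed
    then show ?thesis using pos[OF A(1) B(1) False A(2) B(2)] False by simp
  qed
qed

lemma sum_mset_image_nonneg:
  fixes f :: "'a \<Rightarrow> real"
  shows "(\<And>e. e \<in># E \<Longrightarrow> 0 \<le> f e) \<Longrightarrow> 0 \<le> (\<Sum>e\<in>#E. f e)"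
  by (induction E) auto

definition btw :: "'v set multiset \<Rightarrow> 'v set \<Rightarrow> 'v set \<Rightarrow> int" where
  "btw E A B = int (size (filter_mset (\<lambda>e. e \<inter> A \<noteq> {} \<and> e \<inter> B \<noteq> {}) E))"

lemma cut_Un:
  assumes "mgraph V E" "A \<inter> B = {}"
  shows "cut E (A \<union> B) = cut E A + cut E B - 2 * btw E A B"
  using assms(1)
proof (induction rule: mgraph_induct)
  case (add x y E)
  then show ?case using assms(2) by (auto simp: btw_def crosses_pair)
qed (simp add: btw_def)

lemma btw_pos: "e \<in># E \<Longrightarrow> e \<inter> A \<noteq> {} \<Longrightarrow> e \<inter> B \<noteq> {} \<Longrightarrow> 1 \<le> btw E A B"
proof -
  assume "e \<in># E" "e \<inter> A \<noteq> {}" "e \<inter> B \<noteq> {}"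
  then have "e \<in># filter_mset (\<lambda>e. e \<inter> A \<noteq> {} \<and> e \<inter> B \<noteq> {}) E" by simp
  then have "filter_mset (\<lambda>e. e \<inter> A \<noteq> {} \<and> e \<inter> B \<noteq> {}) E \<noteq> {#}" by (metis empty_not_add_mset insert_DiffM)
  then have "size (filter_mset (\<lambda>e. e \<inter> A \<noteq> {} \<and> e \<inter> B \<noteq> {}) E) \<noteq> 0"
    by (simp only: size_eq_0_iff_empty not_False_eq_True)
  then show ?thesis unfolding btw_def by linarith
qed

lemma cut_independent:
  assumes "mgraph V E" "finite A" "\<And>e. e \<in># E \<Longrightarrow> \<not> e \<subseteq> A" "B \<subseteq> A"
  shows "cut E B = (\<Sum>v\<in>B. cut E {v})"
proof -
  have "filter_mset (\<lambda>e. \<not> e \<subseteq> A) E = E" using assms(3) by (simp add: filter_mset_eq_conv)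
  then show ?thesis using cut_crossing[OF assms(1,4,2)] by simp
qed

text \<open>An edge inside \<open>S\<close> and one inside its complement stand for the two
  nontrivial components of an essential cut.\<close>

locale essentially_23 =
  fixes V :: "'v set" and E
  assumes g: "mgraph V E"
    and five: "\<And>S. S \<noteq> {} \<Longrightarrow> S \<subset> V \<Longrightarrow> 5 \<le> cut E S"
    and ess: "\<And>S e e'. S \<subseteq> V \<Longrightarrow> e \<in># E \<Longrightarrow> e' \<in># E \<Longrightarrow> e \<subseteq> S \<Longrightarrow> e' \<subseteq> V - S \<Longrightarrow> 23 \<le> cut E S"
begin

lemma fin: "finite V" using g mgraph_finite by blast

lemma independent_cut:
  assumes "A \<subset> V" "\<And>e. e \<in># E \<Longrightarrow> \<not> e \<subseteq> A"
  shows "5 * int (card A) \<le> cut E A" "cut E A = (\<Sum>v\<in>A. cut E {v})"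
proof -
  have fA: "finite A" using assms fin finite_subset by blast
  show s: "cut E A = (\<Sum>v\<in>A. cut E {v})" by (rule cut_independent[OF g fA assms(2) order_refl])
  have "(\<Sum>v\<in>A. 5) \<le> (\<Sum>v\<in>A. cut E {v})"
    by (rule sum_mono, rule five) (use assms in auto)
  then show "5 * int (card A) \<le> cut E A" using s by simp
qed

section \<open>Discharging over a partition\<close>

context
  fixes P assumes P: "partition_on V P" and P3: "3 \<le> card P" and V4: "4 \<le> card V"
begin

lemma finP: "finite P" using P fin by (rule finite_elements[rotated])

lemma part: assumes "A \<in> P" shows "A \<noteq> {}" "A \<subset> V" "2 \<le> card (V - A)"
proof -
  show A: "A \<noteq> {}" using P assms by (auto simp: partition_on_def)
  have sub: "A \<subseteq> V" using P assms by (auto simp: partition_on_def)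
  have "2 \<le> card (P - {A})" using P3 assms finP by simp
  then obtain B C where BC: "B \<in> P - {A}" "C \<in> P - {A}" "B \<noteq> C"
    by (metis card_le_Suc0_iff_eq finP finite_Diff not_less_eq_eq numeral_2_eq_2)
  have ne: "B \<noteq> {}" "C \<noteq> {}" using BC P by (auto simp: partition_on_def)
  then obtain x y where xy: "x \<in> B" "y \<in> C" by blast
  have d: "B \<inter> C = {}" "B \<inter> A = {}" "C \<inter> A = {}"
    using disjointD[OF partition_onD2[OF P]] BC assms by blast+
  have "B \<subseteq> V" "C \<subseteq> V" using BC P by (auto simp: partition_on_def)
  then have "{x, y} \<subseteq> V - A" "x \<noteq> y" using xy d by auto
  then have "card {x, y} \<le> card (V - A)" "card {x, y} = 2" using card_mono[of "V - A" "{x, y}"] fin by auto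
  then show "2 \<le> card (V - A)" by simp
  then show "A \<subset> V" using sub by auto
qed

text \<open>Two or more vertices without edges among them have a cut of size at least 10. If
  \<open>A\<close> were not a single vertex, it and its complement would therefore both contain an
  edge, and its cut would have size at least 23.\<close>

lemma low_part:
  assumes A: "A \<in> P" "cut E A \<le> 7"
  obtains u where "A = {u}"
proof (cases "card A = 1")
  case True then show ?thesis using that card_1_singletonE by metis
next
  case False
  have fA: "finite A" using part(2)[OF A(1)] fin finite_subset by blast
  have "card A \<noteq> 0" using part(1)[OF A(1)] fA by simp
  then have c2: "2 \<le> card A" using False by linarith
  have "\<exists>e. e \<in># E \<and> e \<subseteq> A"
    using independent_cut(1)[OF part(2)[OF A(1)]] c2 A(2) by force
  then obtain e where e: "e \<in># E" "e \<subseteq> A" by blast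
  have V: "A \<subseteq> V" "V - A \<subset> V" using part[OF A(1)] by auto
  have "\<exists>e. e \<in># E \<and> e \<subseteq> V - A"
    using independent_cut(1)[OF V(2)] part(3)[OF A(1)] A(2) cut_compl[OF g V(1)] by force
  then obtain e' where "e' \<in># E" "e' \<subseteq> V - A" by blast
  then have "23 \<le> cut E A" using ess[OF V(1) e(1) _ e(2)] by blast
  then show ?thesis using A(2) by simp
qed

text \<open>Cuts adding up to at most 24 give the union of \<open>u\<close> and \<open>B\<close> a
  cut of at most 22, so the \<open>r\<close> remaining vertices have no edges among them and degrees
  adding up to at least \<open>5 * r\<close>. With \<open>k\<close> edges between \<open>u\<close>
  and \<open>B\<close>, the bound \<open>few\<close> then leaves only r + k < 5, and the few
  possible graphs are excluded one after the other.\<close>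

lemma low_neighbour:
  assumes u: "{u} \<in> P" "cut E {u} \<le> 7" and B: "B \<in> P" "B \<noteq> {u}"
    and e: "e \<in># E" "u \<in> e" "e \<inter> B \<noteq> {}"
    and few: "(\<Sum>A\<in>P. cut E A) < 8 * int (card P) - 6"
  shows "25 - cut E {u} \<le> cut E B"
proof (rule ccontr)
  assume small: "\<not> ?thesis"
  have BV: "B \<subseteq> V" "u \<in> V" using part(2)[OF B(1)] part(2)[OF u(1)] by auto
  have uB: "{u} \<inter> B = {}" using disjointD[OF partition_onD2[OF P] u(1) B(1)] B(2) by blast
  let ?k = "btw E {u} B"
  have k1: "1 \<le> ?k" using btw_pos e by blast
  let ?S = "{u} \<union> B"
  let ?R = "V - ?S"
  have SV: "?S \<subseteq> V" using BV by blast
  have cS: "cut E ?S = cut E {u} + cut E B - 2 * ?k" by (rule cut_Un[OF g uB])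
  have eS: "e \<subseteq> ?S"
  proof -
    have "card e = 2" using g e(1) by (simp add: mgraph_def)
    then obtain x y where "e = {x, y}" by (meson card_2_iff)
    then show ?thesis using e uB by auto
  qed
  have indR: "\<not> e' \<subseteq> ?R" if "e' \<in># E" for e'
    using ess[OF SV e(1) that eS] small cS k1 by linarith
  let ?P = "P - {{u}, B}"
  have cPP: "card P = card ?P + 2" and PP: "P = insert {u} (insert B ?P)"
    using u(1) B finP P3 by (auto simp: card_Diff_subset)
  have dis: "A \<inter> ?S = {}" if "A \<in> ?P" for A
    using disjointD[OF partition_onD2[OF P], of A] that u(1) B(1) by blast
  have PR: "partition_on ?R ?P"
  proof (rule partition_onI)
    have "\<Union>P = V" using partition_onD1[OF P] by simp
    then have "\<Union>?P \<union> ?S = V" using u(1) B(1) by blast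
    moreover have "\<Union>?P \<inter> ?S = {}" using dis by blast
    ultimately show "\<Union>?P = ?R" by blast
    show "disjnt A C" if "A \<in> ?P" "C \<in> ?P" "A \<noteq> C" for A C
      using disjointD[OF partition_onD2[OF P], of A C] that by (simp add: disjnt_def)
    show "{} \<notin> ?P" using P by (auto simp: partition_on_def)
  qed
  have finR: "finite ?R" using fin by simp
  have RV: "?R \<subset> V" using BV by blast
  have ne: "?R \<noteq> {}"
  proof
    assume R: "?R = {}"
    have "card ?P \<noteq> 0" using cPP P3 by linarith
    then have "?P \<noteq> {}" by (metis card.empty)
    then obtain A where "A \<in> ?P" by blast
    then have "A \<subseteq> ?R" using partition_onD1[OF PR] by blast
    moreover have "A \<noteq> {}" using P \<open>A \<in> ?P\<close> by (auto simp: partition_on_def)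
    ultimately show False using R by blast
  qed
  let ?r = "int (card ?R)" and ?W = "\<Sum>v\<in>?R. cut E {v}"
  have W: "cut E ?R = ?W" "5 * ?r \<le> ?W" using independent_cut[OF RV indR] by auto
  have cR: "cut E ?R = cut E ?S" by (rule cut_compl[OF g SV])
  have subR: "A \<subseteq> ?R" if "A \<in> ?P" for A using partition_onD1[OF PR] that by blast
  have "(\<Sum>A\<in>?P. cut E A) = (\<Sum>A\<in>?P. \<Sum>v\<in>A. cut E {v})"
    by (rule sum.cong[OF refl], rule cut_independent[OF g finR indR subR])
  then have "(\<Sum>A\<in>?P. cut E A) = ?W" using partition_sum[OF PR finR, of "\<lambda>v. cut E {v}"] by simp
  moreover have "(\<Sum>A\<in>P. cut E A) = cut E {u} + (cut E B + (\<Sum>A\<in>?P. cut E A))"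
    by (subst PP) (use finP B(2) in simp)
  ultimately have total: "(\<Sum>A\<in>P. cut E A) = cut E {u} + cut E B + ?W" by simp
  have "card ?P \<le> card ?R"
  proof -
    have "(\<Sum>A\<in>?P. 1) \<le> (\<Sum>A\<in>?P. card A)"
    proof (rule sum_mono)
      fix A assume A: "A \<in> ?P"
      have "finite A" using subR[OF A] finR by (rule finite_subset)
      moreover have "A \<noteq> {}" using P A by (auto simp: partition_on_def)
      ultimately show "1 \<le> card A" by (simp add: Suc_le_eq card_gt_0_iff)
    qed
    also have "\<dots> = card ?R" using partition_sum[OF PR finR, of "\<lambda>_. 1::nat"] by simp
    finally show ?thesis by simp
  qed
  \<comment> \<open>There are at most \<open>?r\<close> parts besides \<open>{u}\<close> and
    \<open>B\<close>, so 8 |P| - 6 is at most 8 \<open>?r\<close> + 10.\<close>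
  then have few': "cut E {u} + cut E B + ?W < 8 * ?r + 10" using few total cPP by linarith
  have WW: "2 * ?W + 2 * ?k < 8 * ?r + 10" using few' cS cR W(1) by linarith
  have u5: "5 \<le> cut E {u}" using five[of "{u}"] part(2)[OF u(1)] by blast
  \<comment> \<open>Otherwise all edges at \<open>u\<close> go to \<open>B\<close>, so
    \<open>?k\<close> is the degree of \<open>u\<close>, at least 5 and too large for
    \<open>WW\<close>.\<close>
  have "\<exists>e'. e' \<in># E \<and> u \<in> e' \<and> e' \<inter> ?R \<noteq> {}"
  proof (rule ccontr)
    assume n: "\<not> ?thesis"
    then have "filter_mset (\<lambda>e. e \<inter> {u} \<noteq> {} \<and> e \<inter> ?R \<noteq> {}) E = {#}"
      by (auto simp: filter_mset_eq_mempty_iff)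
    then have "btw E {u} ?R = 0" by (simp add: btw_def)
    then have "cut E ({u} \<union> ?R) = cut E {u} + cut E ?R"
      using cut_Un[OF g, of "{u}" ?R] by simp
    moreover have "cut E ({u} \<union> ?R) = cut E B"
    proof -
      have "{u} \<union> ?R = V - B" using BV uB by blast
      then show ?thesis using cut_compl[OF g BV(1)] by simp
    qed
    ultimately have "?k = cut E {u}" using cS cR by linarith
    then show False using WW W(2) u5 ne finR card_gt_0_iff[of ?R] by linarith
  qed
  then obtain f x where f: "f \<in># E" "u \<in> f" "x \<in> f" "x \<in> ?R" by blast
  have ux: "u \<noteq> x" using f by auto
  have fux: "f = {u, x}"
  proof -
    have "card f = 2" using g f(1) by (simp add: mgraph_def)
    then obtain a c where "f = {a, c}" by (meson card_2_iff)
    then show ?thesis using f ux by auto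
  qed
  let ?T = "{u} \<union> {x}"
  have TV: "?T \<subseteq> V" using BV f by blast
  have cT: "cut E ?T \<le> cut E {u} + cut E {x} - 2"
    using cut_Un[OF g, of "{u}" "{x}"] btw_pos[OF f(1), of "{u}" "{x}"] f ux by auto
  have xW: "cut E {x} + 5 * (?r - 1) \<le> ?W"
  proof -
    have "(\<Sum>v\<in>?R - {x}. 5) \<le> (\<Sum>v\<in>?R - {x}. cut E {v})"
      by (rule sum_mono, rule five) (use BV ux f in auto)
    moreover have "?W = cut E {x} + (\<Sum>v\<in>?R - {x}. cut E {v})" by (rule sum.remove[OF finR f(4)])
    moreover have "card (?R - {x}) = card ?R - 1" by (rule card_Diff_singleton[OF f(4)])
    moreover have "1 \<le> card ?R" using f(4) finR card_gt_0_iff[of ?R] by auto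
    ultimately show ?thesis by simp
  qed
  \<comment> \<open>An edge avoiding \<open>u\<close> and \<open>x\<close> would force degree at
    least 18 at \<open>x\<close>, which makes \<open>?W\<close> too large for
    \<open>WW\<close>.\<close>
  have indT: "\<not> e' \<subseteq> V - ?T" if "e' \<in># E" for e'
  proof
    assume "e' \<subseteq> V - ?T"
    then have "23 \<le> cut E ?T" using ess[OF TV f(1) that] fux by blast
    then have "18 \<le> cut E {x}" using cT u(2) by linarith
    moreover have False if "18 \<le> a" "a + 5 * (r - 1) \<le> w" "2 * w + 2 * k < 8 * r + 10" "1 \<le> k" "0 \<le> r"
      for a r w k :: int using that by presburger
    ultimately show False using xW WW k1 of_nat_0_le_iff by blast
  qed
  \<comment> \<open>A further vertex \<open>y\<close> of \<open>?R\<close> would have all its edges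
    at \<open>u\<close>, and the cut of \<open>{u, y}\<close> would have at most 7 - 5
    edges.\<close>
  have Rx: "?R = {x}"
  proof (rule ccontr)
    assume "?R \<noteq> {x}"
    then obtain y where y: "y \<in> ?R" "y \<noteq> x" using f(4) by blast
    have "crosses e' {y} \<longleftrightarrow> e' \<inter> {u} \<noteq> {} \<and> e' \<inter> {y} \<noteq> {}" if e': "e' \<in># E" for e'
    proof -
      have "card e' = 2" "e' \<subseteq> V" using g e' by (auto simp: mgraph_def)
      then obtain a c where ac: "e' = {a, c}" "a \<noteq> c" by (meson card_2_iff)
      show ?thesis
      proof (cases "y \<in> e'")
        case True
        then obtain d where d: "e' = {y, d}" "d \<noteq> y" "d \<in> V" using ac \<open>e' \<subseteq> V\<close> by auto
        have "d \<notin> ?R" using indR[OF e'] d y by blast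
        moreover have "d \<in> ?T" using indT[OF e'] d y by blast
        ultimately have "d = u" using f(4) by blast
        then show ?thesis using d by (auto simp: crosses_pair)
      qed (auto simp: crosses_def)
    qed
    then have "filter_mset (\<lambda>e. crosses e {y}) E = filter_mset (\<lambda>e. e \<inter> {u} \<noteq> {} \<and> e \<inter> {y} \<noteq> {}) E"
      by (intro filter_mset_cong) auto
    then have "cut E {y} = btw E {u} {y}" by (simp add: cut_def btw_def)
    then have c: "cut E ({u} \<union> {y}) = cut E {u} - cut E {y}" using cut_Un[OF g, of "{u}" "{y}"] y by simp
    have "{u} \<union> {y} \<subset> V" using y f(4) BV(2) by blast
    then have "5 \<le> cut E ({u} \<union> {y})" using five[of "{u} \<union> {y}"] by simp
    moreover have "{y} \<subset> V" using y f(4) by blast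
    then have "5 \<le> cut E {y}" using five[of "{y}"] by simp
    ultimately show False using c u(2) by linarith
  qed
  have r1: "?r = 1" using Rx by simp
  have "V = insert u (insert x B)" using Rx BV by blast
  moreover have "finite B" using BV(1) fin by (rule finite_subset)
  then have "card (insert u (insert x B)) \<le> card B + 2" by (simp add: card_insert_if)
  ultimately have "card V \<le> card B + 2" by (simp only:)
  then have "2 \<le> card B" using V4 by linarith
  moreover have "\<not> e' \<subseteq> B" if "e' \<in># E" for e'
    using indT[OF that] BV uB f(4) by blast
  then have "5 * int (card B) \<le> cut E B" using independent_cut(1)[OF part(2)[OF B(1)]] by blast
  \<comment> \<open>\<open>B\<close> has at least two vertices and no edge, hence a cut of at least
    10; with 5 at \<open>u\<close> and 5 at \<open>x\<close> this is not below 8 + 10.\<close>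
  ultimately show False using few' r1 u5 W(2) by linarith
qed

text \<open>Writing \<open>d(A)\<close> for the size of the cut of a part \<open>A\<close>, the sum of \<open>d(A) - 8\<close> is the sum
  of \<open>2 - 8 / d(A) - 8 / d(B)\<close> over the edges joining distinct parts \<open>A\<close> and \<open>B\<close>.\<close>

lemma partition_bound: "8 * int (card P) - 6 \<le> (\<Sum>A\<in>P. cut E A)"
proof (rule ccontr)
  assume "\<not> ?thesis"
  then have few: "(\<Sum>A\<in>P. cut E A) < 8 * int (card P) - 6" by simp
  let ?f = "\<lambda>A. 1 - 8 / real_of_int (cut E A)"
  have c5: "5 \<le> cut E A" if "A \<in> P" for A using five part[OF that] by blast
  have low: "0 \<le> ?f A + ?f B"
    if AB: "A \<in> P" "B \<in> P" "A \<noteq> B" "x \<in> A" "y \<in> B" "{x, y} \<in># E" and lo: "cut E A \<le> 7" for A B x y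
  proof -
    obtain u where Au: "A = {u}" using low_part[OF AB(1) lo] .
    then have "25 - cut E {u} \<le> cut E B"
      using low_neighbour[of u B "{x, y}"] AB lo few by auto
    moreover have "cut E {u} = 5 \<or> cut E {u} = 6 \<or> cut E {u} = 7" using c5[OF AB(1)] lo Au by auto
    \<comment> \<open>In each case the reciprocals add up to at most 1/4, with equality only for 5
      and 20.\<close>
    ultimately have "(cut E {u} = 5 \<and> 20 \<le> cut E B) \<or> (cut E {u} = 6 \<and> 19 \<le> cut E B) \<or> (cut E {u} = 7 \<and> 18 \<le> cut E B)"
      by auto
    then have "(cut E {u} = 5 \<and> 20 \<le> real_of_int (cut E B)) \<or> (cut E {u} = 6 \<and> 19 \<le> real_of_int (cut E B))
       \<or> (cut E {u} = 7 \<and> 18 \<le> real_of_int (cut E B))" by linarith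
    then show ?thesis unfolding Au by (elim disjE) (auto simp: field_simps)
  qed
  have "0 \<le> (\<Sum>A\<in>P. ?f A * of_bool (crosses e A))" if e: "e \<in># E" for e
  proof -
    have "card e = 2" "e \<subseteq> V" using g e by (auto simp: mgraph_def)
    then obtain x y where xy: "e = {x, y}" "x \<in> V" "y \<in> V" by (metis card_2_iff insert_subset)
    show ?thesis unfolding xy(1)
    proof (rule weighted_edge_nonneg[OF P finP xy(2,3)])
      fix A B assume AB: "A \<in> P" "B \<in> P" "A \<noteq> B" "x \<in> A" "y \<in> B"
      show "0 \<le> ?f A + ?f B"
      proof (cases "cut E A \<le> 7 \<or> cut E B \<le> 7")
        case True
        then show ?thesis
        proof
          assume "cut E A \<le> 7" then show ?thesis using low[OF AB] e xy by blast
        next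
          assume "cut E B \<le> 7"
          then have "0 \<le> ?f B + ?f A" using low[of B A y x] AB e xy by (simp add: insert_commute)
          then show ?thesis by simp
        qed
      next
        case False
        then have "8 \<le> real_of_int (cut E A)" "8 \<le> real_of_int (cut E B)" by auto
        then have "0 \<le> ?f A" "0 \<le> ?f B" by (auto simp: field_simps)
        then show ?thesis by simp
      qed
    qed
  qed
  then have "0 \<le> (\<Sum>e\<in>#E. \<Sum>A\<in>P. ?f A * of_bool (crosses e A))"
    by (rule sum_mset_image_nonneg)
  also have "\<dots> = (\<Sum>A\<in>P. ?f A * of_int (cut E A))" by (rule weighted_cut_sum[OF finP, symmetric])
  also have "\<dots> = (\<Sum>A\<in>P. of_int (cut E A) - 8)"
    by (rule sum.cong) (use c5 in \<open>force simp: field_simps\<close>)+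
  also have "\<dots> = of_int ((\<Sum>A\<in>P. cut E A) - 8 * int (card P))" by (simp add: sum_subtractf)
  finally have "0 \<le> (\<Sum>A\<in>P. cut E A) - 8 * int (card P)" by linarith
  then show False using few by simp
qed

end

theorem delete_vertex_sol:
  assumes z: "z \<in> V" "cut E {z} = 5"
    and b: "\<And>v. v \<in> V - {z} \<Longrightarrow> even (b v - cut (filter_mset (\<lambda>e. e \<subseteq> V - {z}) E) {v})"
      "6 dvd sum b (V - {z})"
  shows "sol (V - {z}) (filter_mset (\<lambda>e. e \<subseteq> V - {z}) E) b"
proof -
  let ?V = "V - {z}"
  let ?H = "filter_mset (\<lambda>e. e \<subseteq> ?V) E" and ?Z = "filter_mset (\<lambda>e. \<not> e \<subseteq> ?V) E"
  have finV: "finite ?V" using fin by simp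
  have gH: "mgraph ?V ?H" and gZ: "mgraph V ?Z" using g finV by (auto simp: mgraph_def)
  have sp: "cut E A = cut ?H A + cut ?Z A" for A by (rule cut_filter_split)
  have cZ: "cut ?Z A = (\<Sum>v\<in>A. cut ?Z {v})" if "A \<subseteq> ?V" for A by (rule cut_crossing[OF g that finV])
  have "cut ?Z ?V = cut E ?V" using sp[of ?V] cut_whole[OF gH] by simp
  then have Z5: "cut ?Z ?V = 5" using cut_compl[OF g, of "{z}"] z by simp
  have "V \<noteq> {z}" using z cut_whole[OF g] by auto
  then have ne: "?V \<noteq> {}" using z by blast
  have "card V = card ?V + 1" using card.remove[OF fin z(1)] by simp
  moreover have "card ?V \<noteq> 0" using ne finV by simp
  ultimately consider "card ?V = 1" | "card ?V = 2" | "4 \<le> card V" by linarith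
  then show ?thesis
  proof cases
    case 1
    then obtain w where w: "?V = {w}" by (rule card_1_singletonE)
    then show ?thesis using sol_single_vertex[of w] gH b(2) by simp
  next
    case 2
    then obtain u w where uw: "?V = {u, w}" "u \<noteq> w" by (meson card_2_iff)
    have V: "u \<in> V" "w \<in> V" "{u} \<subset> V" "{w} \<subset> V" using uw z by auto
    have H: "?H = replicate_mset (size ?H) {u, w}"
      by (rule parallel_edges) (use gH uw(1) in simp)
    have cr: "cut (replicate_mset n {u, w}) {u} = int n \<and> cut (replicate_mset n {u, w}) {w} = int n" for n
      using uw(2) by (induction n) (auto simp: crosses_pair)
    then have cH: "cut ?H {u} = int (size ?H)" "cut ?H {w} = int (size ?H)" using H by metis+
    have "cut ?Z {u} + cut ?Z {w} = 5" using Z5 cZ[of ?V] uw by simp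
    \<comment> \<open>The degrees of \<open>u\<close> and \<open>w\<close> add up to at least 10,
      and edges to \<open>z\<close> account for only 5, so the parallel edges supply at least 5 edge
      ends.\<close>
    then have s2: "2 \<le> size ?H" using five[of "{u}"] five[of "{w}"] V sp[of "{u}"] sp[of "{w}"] cH by simp
    have ev: "even (b u - int (size ?H))" using b(1)[of u] cH uw by auto
    have "6 dvd b u + b w" using b(2) uw by simp
    then have "sol {u, w} (replicate_mset (size ?H) {u, w}) b" by (rule sol_parallel[where b = b, OF s2 uw(2) ev])
    then show ?thesis using H uw(1) by metis
  next
    case 3
    have "dense ?V ?H"
      unfolding dense_def
    proof (intro conjI gH allI impI)
      fix Q assume Q: "partition_on ?V Q"
      have fQ: "finite Q" using Q finV by (rule finite_elements[rotated])
      have QA: "A \<subseteq> ?V" "A \<noteq> {}" if "A \<in> Q" for A using Q that by (auto simp: partition_on_def)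
      show "8 * (int (card Q) - 1) \<le> (\<Sum>A\<in>Q. cut ?H A)"
      proof (cases "2 \<le> card Q")
        case False
        then have "8 * (int (card Q) - 1) \<le> 0" by simp
        also have "0 \<le> (\<Sum>A\<in>Q. cut ?H A)" by (rule sum_nonneg) simp
        finally show ?thesis .
      next
        case True
        let ?P = "insert {z} Q"
        have P: "partition_on V ?P"
        proof -
          have "V = insert z ?V" using z by blast
          then show ?thesis using Q unfolding partition_on_def disjoint_def by auto
        qed
        have zQ: "{z} \<notin> Q" using QA by blast
        have cP: "card ?P = card Q + 1" using fQ zQ by simp
        \<comment> \<open>The five edges at \<open>z\<close> disappear twice, from the cut of
          \<open>{z}\<close> and from the cuts of the parts in \<open>Q\<close>: 8 (|Q| + 1) - 6 -
          10 = 8 (|Q| - 1).\<close>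
        have "8 * int (card ?P) - 6 \<le> (\<Sum>A\<in>?P. cut E A)"
          by (rule partition_bound[OF P _ 3]) (use True cP in simp)
        moreover have "(\<Sum>A\<in>?P. cut E A) = 5 + (\<Sum>A\<in>Q. cut E A)" using fQ zQ z(2) by simp
        moreover have "(\<Sum>A\<in>Q. cut E A) = (\<Sum>A\<in>Q. cut ?H A) + (\<Sum>A\<in>Q. cut ?Z A)"
          unfolding sum.distrib[symmetric] by (rule sum.cong) (simp_all add: sp[symmetric])
        moreover have "(\<Sum>A\<in>Q. cut ?Z A) = (\<Sum>A\<in>Q. \<Sum>v\<in>A. cut ?Z {v})"
          by (rule sum.cong) (use cZ QA in auto)
        moreover have "(\<Sum>A\<in>Q. \<Sum>v\<in>A. cut ?Z {v}) = 5"
          using partition_sum[OF Q finV, of "\<lambda>v. cut ?Z {v}"] cZ[of ?V] Z5 by simp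
        ultimately show ?thesis using cP by simp
      qed
    qed
    then show ?thesis using dense_imp_sol ne b by blast
  qed
qed

end

section \<open>Transfer to multigraphs with labelled edges\<close>

definition edge_mset :: "('v, 'e) pre_multigraph \<Rightarrow> 'v set multiset" where
  "edge_mset G = image_mset (ends G) (mset_set (edges G))"

lemma size_filter_image_mset_set:
  assumes "finite A"
  shows "size (filter_mset P (image_mset f (mset_set A))) = card {a \<in> A. P (f a)}"
proof -
  have "filter_mset P (image_mset f (mset_set A)) = image_mset f (mset_set {a \<in> A. P (f a)})"
    using assms by (simp add: filter_mset_image_mset filter_mset_mset_set)
  then show ?thesis using assms by simp
qed

context multigraph
begin

lemma edge_mset_mgraph: "mgraph (vertices G) (edge_mset G)"
  using finite_vertices finite_edges ends_in_vertices two_ends by (auto simp: mgraph_def edge_mset_def)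

lemma pair_ends:
  assumes "e \<in> edges G"
  obtains x y where "ends G e = {x, y}" "x \<noteq> y"
  using two_ends[OF assms] by (meson card_2_iff)

lemma cut_edge_mset: "cut (edge_mset G) S = int (card (boundary G S))"
proof -
  have "crosses (ends G e) S \<longleftrightarrow> card (ends G e \<inter> S) = 1" if e: "e \<in> edges G" for e
  proof -
    obtain x y where "ends G e = {x, y}" "x \<noteq> y" using pair_ends[OF e] .
    then show ?thesis by (cases "x \<in> S"; cases "y \<in> S") (simp_all add: crosses_pair Int_insert_left)
  qed
  then have "{e \<in> edges G. crosses (ends G e) S} = boundary G S" by (auto simp: boundary_def)
  then show ?thesis
    using size_filter_image_mset_set[OF finite_edges, of "\<lambda>e. crosses e S" "ends G"] by (simp add: cut_def edge_mset_def)
qed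

lemma boundary_singleton: "boundary G {z} = incident_edges G z"
proof -
  have "card (ends G e \<inter> {z}) = 1 \<longleftrightarrow> z \<in> ends G e" for e by (cases "z \<in> ends G e") simp_all
  then show ?thesis by (simp add: boundary_def incident_edges_def)
qed

lemma adjacency_closed:
  assumes "(u, v) \<in> (adjacency (delete_edges G (boundary G S)))\<^sup>*"
  shows "u \<in> S \<longleftrightarrow> v \<in> S"
  using assms
proof (induction rule: rtrancl_induct)
  case (step v w)
  then obtain e where e: "e \<in> edges G" "e \<notin> boundary G S" "ends G e = {v, w}"
    by (auto simp: adjacency_def delete_edges_def spanning_subgraph_def)
  then have "v \<noteq> w" using two_ends[OF e(1)] by auto
  then have "v \<in> S \<longleftrightarrow> w \<in> S"
    using e by (cases "v \<in> S"; cases "w \<in> S") (auto simp: boundary_def Int_insert_left)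
  then show ?case using step.IH by blast
qed simp

lemma edge_connected_cut:
  assumes "k_edge_connected k G" "S \<noteq> {}" "S \<subset> vertices G"
  shows "int k \<le> cut (edge_mset G) S"
proof (rule ccontr)
  assume "\<not> ?thesis"
  then have "card (boundary G S) < k" by (simp add: cut_edge_mset)
  moreover have "boundary G S \<subseteq> edges G" by (auto simp: boundary_def)
  ultimately have c: "connected_graph (delete_edges G (boundary G S))"
    using assms(1) by (simp add: k_edge_connected_def)
  obtain s t where "s \<in> S" "t \<in> vertices G" "t \<notin> S" using assms by blast
  moreover then have "s \<in> vertices G" using assms by blast
  ultimately have "(s, t) \<in> (adjacency (delete_edges G (boundary G S)))\<^sup>*"
    using c by (simp add: connected_graph_def connectedness_def delete_edges_def spanning_subgraph_def)
  then show False using adjacency_closed \<open>s \<in> S\<close> \<open>t \<notin> S\<close> by blast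
qed

text \<open>An edge inside one side is not in the boundary, so both its ends lie in one component,
  which cannot leave that side.\<close>

lemma nontrivial_component:
  assumes e: "e \<in> edges G" "ends G e \<subseteq> T" "T = S \<or> T = vertices G - S"
  obtains C where "C \<in> components (delete_edges G (boundary G S))" "C \<noteq> {}" "1 < card C" "C \<subseteq> T"
proof -
  let ?D = "delete_edges G (boundary G S)"
  obtain x y where xy: "ends G e = {x, y}" "x \<noteq> y" using pair_ends[OF e(1)] .
  have V: "x \<in> vertices G" "y \<in> vertices G" using ends_in_vertices[OF e(1)] xy by auto
  have "e \<notin> boundary G S"
    using e xy by (auto simp: boundary_def Int_insert_left)
  then have adj: "(x, y) \<in> adjacency ?D"
    using e(1) xy by (auto simp: adjacency_def delete_edges_def spanning_subgraph_def)
  have vD: "vertices ?D = vertices G" by (simp add: delete_edges_def spanning_subgraph_def)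
  let ?C = "connectedness ?D `` {x}"
  have "?C \<in> components ?D" unfolding components_def vD using V(1) by (rule quotientI)
  moreover have sub: "?C \<subseteq> vertices G" by (auto simp: connectedness_def vD)
  moreover have in_C: "{x, y} \<subseteq> ?C" using V adj by (auto simp: connectedness_def vD)
  moreover have "card {x, y} \<le> card ?C" by (rule card_mono[OF finite_subset[OF sub finite_vertices] in_C])
  then have "1 < card ?C" using xy(2) by simp
  moreover have "?C \<subseteq> T"
  proof
    fix w assume "w \<in> ?C"
    then have w: "w \<in> vertices G" "x \<in> S \<longleftrightarrow> w \<in> S"
      using adjacency_closed by (auto simp: connectedness_def vD)
    then show "w \<in> T" using e(2,3) xy by auto
  qed
  ultimately show ?thesis using that[of ?C] by blast
qed

lemma essentially_connected_cut:
  assumes k: "essentially_k_edge_connected k G" and S: "S \<subseteq> vertices G"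
    and e: "e \<in> edges G" "ends G e \<subseteq> S" and e': "e' \<in> edges G" "ends G e' \<subseteq> vertices G - S"
  shows "int k \<le> cut (edge_mset G) S"
proof (rule ccontr)
  assume "\<not> ?thesis"
  then have small: "card (boundary G S) < k" by (simp add: cut_edge_mset)
  obtain C where C: "C \<in> components (delete_edges G (boundary G S))" "C \<noteq> {}" "1 < card C" "C \<subseteq> S"
    using nontrivial_component[OF e, of S] by auto
  obtain C' where C': "C' \<in> components (delete_edges G (boundary G S))" "C' \<noteq> {}" "1 < card C'" "C' \<subseteq> vertices G - S"
    using nontrivial_component[OF e', of S] by auto
  have "S \<noteq> {}" using C by auto
  moreover have "S \<noteq> vertices G" using C' by auto
  ultimately have "edge_cut G (boundary G S)" using S unfolding edge_cut_def by blast
  moreover have "C \<noteq> C'" using C C' by blast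
  ultimately have "essential_edge_cut G (boundary G S)"
    using C C' unfolding essential_edge_cut_def by blast
  then show False using k small unfolding essentially_k_edge_connected_def by blast
qed

end

lemma three_eq_0: "(3 :: 3) = 0" by simp

lemma of_int_3_eq_0_iff: "(of_int k :: 3) = 0 \<longleftrightarrow> 3 dvd k"
proof -
  have "(of_int k :: 3) = of_int (3 * (k div 3) + k mod 3)" by simp
  also have "\<dots> = of_int (k mod 3)" 
    by (simp only: of_int_add of_int_mult of_int_numeral three_eq_0 mult_zero_left add_0)
  finally have eq: "(of_int k :: 3) = of_int (k mod 3)" .
  have "0 \<le> k mod 3" "k mod 3 < 3" by simp_all
  then have "k mod 3 = 0 \<or> k mod 3 = 1 \<or> k mod 3 = 2" by linarith
  then show ?thesis unfolding eq dvd_eq_mod_eq_0 by (elim disjE) simp_all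
qed

lemma of_int_3_surj: "\<exists>k. (of_int k :: 3) = x"
  by (cases x) auto

lemma net_out_degree_sum:
  assumes "finite (arcs D)"
  shows "net_out_degree D v = (\<Sum>e\<in>arcs D. of_bool (tail D e = v) - of_bool (head D e = v))"
proof -
  have "(\<Sum>e\<in>arcs D. of_bool (f e = v)) = (of_nat (card {e \<in> arcs D. f e = v}) :: 3)" for f
    using assms by (simp add: of_bool_def sum.If_cases Int_def)
  then show ?thesis
    by (simp add: net_out_degree_def out_degree_def in_degree_def out_arcs_def in_arcs_def sum_subtractf)
qed

text \<open>Equality of multisets only says that some matching of labelled edges with pairs exists;
  the induction constructs one, which orients each edge individually.\<close>

lemma multiset_orientation_function:
  assumes "finite A" "image_mset und F = image_mset f (mset_set A)"
  shows "\<exists>r. (\<forall>a\<in>A. und (r a) = f a) \<and> image_mset r (mset_set A) = F"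
  using assms
proof (induction A arbitrary: F rule: finite_induct)
  case (insert a A)
  then have "image_mset und F = add_mset (f a) (image_mset f (mset_set A))" by simp
  from msed_map_invR[OF this] obtain q F'
    where q: "F = add_mset q F'" "und q = f a" "image_mset und F' = image_mset f (mset_set A)" by auto
  from insert.IH[OF q(3)] obtain r
    where r: "\<forall>a\<in>A. und (r a) = f a" "image_mset r (mset_set A) = F'" by blast
  have "image_mset (r(a := q)) (mset_set A) = F'"
    using r(2) insert.hyps by (metis (no_types, lifting) elem_mset_set fun_upd_other image_mset_cong)
  then have "image_mset (r(a := q)) (mset_set (insert a A)) = F"
    unfolding mset_set.insert[OF insert.hyps] image_mset_add_mset q(1) by simp
  moreover have "\<forall>c\<in>insert a A. und ((r(a := q)) c) = f c" using q(2) r(1) by simp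
  ultimately show ?case by blast
qed simp

lemma Z3_extendable:
  assumes mg: "multigraph G" and k5: "k_edge_connected 5 G" and e23: "essentially_k_edge_connected 23 G"
    and z: "z \<in> vertices G" "degree G z = 5"
  shows "Z3_extendable_at G z"
  unfolding Z3_extendable_at_def
proof (intro allI impI, elim conjE)
  fix \<beta> D\<^sub>0
  assume zs: "zero_sum G \<beta>" and pre: "pre_orientation_at G z D\<^sub>0" and nz: "net_out_degree D\<^sub>0 z = \<beta> z"
  interpret multigraph G by (rule mg)
  let ?V = "vertices G" and ?E = "edge_mset G" and ?I = "incident_edges G z"
  let ?U = "vertices G - {z}" and ?F = "edges G - incident_edges G z"
  have ess: "essentially_23 ?V ?E"
  proof
    show "mgraph ?V ?E" by (rule edge_mset_mgraph)
    show "5 \<le> cut ?E S" if "S \<noteq> {}" "S \<subset> ?V" for S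
      using edge_connected_cut[OF k5 that] by simp
    show "23 \<le> cut ?E S" if S: "S \<subseteq> ?V" and e: "e \<in># ?E" "e' \<in># ?E" "e \<subseteq> S" "e' \<subseteq> ?V - S" for S e e'
    proof -
      obtain d d' where "d \<in> edges G" "e = ends G d" "d' \<in> edges G" "e' = ends G d'"
        using e(1,2) finite_edges by (auto simp: edge_mset_def)
      then show ?thesis using essentially_connected_cut[OF e23 S, of d d'] e(3,4) by simp
    qed
  qed
  let ?H = "filter_mset (\<lambda>e. e \<subseteq> ?U) ?E"
  have H: "?H = image_mset (ends G) (mset_set ?F)"
  proof -
    have "{e \<in> edges G. ends G e \<subseteq> ?U} = ?F" using ends_in_vertices by (auto simp: incident_edges_def)
    then show ?thesis using finite_edges by (simp add: edge_mset_def filter_mset_image_mset filter_mset_mset_set)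
  qed
  have finU: "finite ?U" using finite_vertices by simp
  have gH: "mgraph ?U ?H" using edge_mset_mgraph finU by (auto simp: mgraph_def)
  have arcs0: "arcs D\<^sub>0 = ?I" and ends0: "\<And>e. e \<in> ?I \<Longrightarrow> {tail D\<^sub>0 e, head D\<^sub>0 e} = ends G e"
    using pre by (auto simp: pre_orientation_at_def orientation_of_def spanning_subgraph_def)
  have IE: "?I \<subseteq> edges G" by (auto simp: incident_edges_def)
  have finI: "finite ?I" and finF: "finite ?F" using IE finite_edges finite_subset by auto
  \<comment> \<open>Each arc cancels between its tail and its head, so the pre-orientation
    contributes 0 in total. As it already meets the prescription at \<open>z\<close>, what remains
    to be prescribed on \<open>?U\<close> has sum 0.\<close>
  have "(\<Sum>v\<in>?V. net_out_degree D\<^sub>0 v) = (\<Sum>v\<in>?V. \<Sum>e\<in>?I. of_bool (tail D\<^sub>0 e = v) - of_bool (head D\<^sub>0 e = v))"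
    using net_out_degree_sum[of D\<^sub>0] finI arcs0 by simp
  also have "\<dots> = (\<Sum>e\<in>?I. \<Sum>v\<in>?V. of_bool (tail D\<^sub>0 e = v) - of_bool (head D\<^sub>0 e = v))" by (rule sum.swap)
  also have "\<dots> = 0"
  proof (rule sum.neutral, rule ballI)
    fix e assume e: "e \<in> ?I"
    then have "tail D\<^sub>0 e \<in> ?V" "head D\<^sub>0 e \<in> ?V" using ends0[OF e] ends_in_vertices IE by blast+
    then show "(\<Sum>v\<in>?V. of_bool (tail D\<^sub>0 e = v) - of_bool (head D\<^sub>0 e = v)) = (0 :: 3)"
      using finite_vertices by (simp add: sum_subtractf of_bool_def)
  qed
  finally have sum0: "(\<Sum>v\<in>?V. net_out_degree D\<^sub>0 v) = 0" .
  define t where "t v = (SOME k. (of_int k :: 3) = \<beta> v - net_out_degree D\<^sub>0 v)" for v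
  have t: "(of_int (t v) :: 3) = \<beta> v - net_out_degree D\<^sub>0 v" for v
    unfolding t_def using of_int_3_surj by (rule someI_ex)
  \<comment> \<open>\<open>b v\<close> is congruent to \<open>t v\<close> modulo 3 and to the degree of \<open>v\<close> modulo 2.\<close>
  define b where "b v = 3 * cut ?H {v} - 2 * t v" for v
  have b3: "(of_int (b v) :: 3) = \<beta> v - net_out_degree D\<^sub>0 v" for v
  proof -
    have "(of_int (b v) :: 3) = of_int (t v) + of_int (3 * (cut ?H {v} - t v))" by (simp add: b_def)
    also have "(of_int (3 * (cut ?H {v} - t v)) :: 3) = 0" by (subst of_int_3_eq_0_iff) simp
    finally show ?thesis using t[of v] by simp
  qed
  have par: "even (b v - cut ?H {v})" for v by (simp add: b_def)
  have "even (sum b ?U - (\<Sum>v\<in>?U. cut ?H {v}))" by (rule even_sum_diff) (rule par)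
  then have "even (sum b ?U)" using cut_parity[OF gH finU] cut_whole[OF gH] by simp
  moreover have "3 dvd sum b ?U"
  proof -
    have "(of_int (sum b ?U) :: 3) = (\<Sum>v\<in>?U. \<beta> v - net_out_degree D\<^sub>0 v)" by (simp add: b3)
    also have "\<dots> = (\<Sum>v\<in>?V. \<beta> v - net_out_degree D\<^sub>0 v) - (\<beta> z - net_out_degree D\<^sub>0 z)"
      using finite_vertices z(1) by (simp add: sum_diff1)
    also have "\<dots> = 0" using zs sum0 nz by (simp add: sum_subtractf zero_sum_def)
    finally show ?thesis by (simp only: of_int_3_eq_0_iff)
  qed
  ultimately have six: "6 dvd sum b ?U" by presburger
  have "cut ?E {z} = 5" using z(2) by (simp add: cut_edge_mset boundary_singleton degree_def)
  then have "sol ?U ?H b"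
    using essentially_23.delete_vertex_sol[OF ess z(1) _ par six] by blast
  then obtain F where F: "image_mset und F = ?H" "\<forall>v\<in>?U. 6 dvd net F v - b v" by (auto simp: sol_def)
  obtain r where r: "\<forall>e\<in>?F. und (r e) = ends G e" "image_mset r (mset_set ?F) = F"
    using multiset_orientation_function[OF finF] F(1) H by metis
  define D where "D = \<lparr>verts = ?V, arcs = edges G,
    tail = (\<lambda>e. if e \<in> ?I then tail D\<^sub>0 e else fst (r e)),
    head = (\<lambda>e. if e \<in> ?I then head D\<^sub>0 e else snd (r e))\<rparr>"
  have orient: "orientation_of G D"
    using ends0 r(1) by (auto simp: orientation_of_def D_def und_def)
  have "extends D D\<^sub>0" using IE arcs0 by (auto simp: extends_def D_def)
  moreover have "net_out_degree D v = \<beta> v" if v: "v \<in> ?V" for v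
  proof -
    let ?g = "\<lambda>e. of_bool (tail D e = v) - of_bool (head D e = v) :: 3"
    have "net_out_degree D v = (\<Sum>e\<in>edges G. ?g e)"
      using net_out_degree_sum[of D v] finite_edges by (simp add: D_def)
    also have "\<dots> = (\<Sum>e\<in>?F. ?g e) + (\<Sum>e\<in>?I. ?g e)" by (rule sum.subset_diff[OF IE finite_edges])
    also have "(\<Sum>e\<in>?I. ?g e) = net_out_degree D\<^sub>0 v"
      using net_out_degree_sum[of D\<^sub>0 v] arcs0 finI by (simp add: D_def)
    also have "(\<Sum>e\<in>?F. ?g e) = of_int (net F v)"
    proof -
      have "net F v = (\<Sum>e\<in>?F. of_bool (fst (r e) = v) - of_bool (snd (r e) = v))"
        unfolding net_def r(2)[symmetric] by (simp add: sum_unfold_sum_mset multiset.map_comp o_def)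
      then have "(of_int (net F v) :: 3) = (\<Sum>e\<in>?F. of_bool (fst (r e) = v) - of_bool (snd (r e) = v))"
        by simp
      also have "\<dots> = (\<Sum>e\<in>?F. ?g e)" by (rule sum.cong) (auto simp: D_def)
      finally show ?thesis by simp
    qed
    finally have n: "net_out_degree D v = of_int (net F v) + net_out_degree D\<^sub>0 v" .
    show ?thesis
    proof (cases "v = z")
      case True
      then have "net F v = 0" using net_outside[OF gH F(1)] by simp
      then show ?thesis using n nz True by simp
    next
      case False
      then have "6 dvd net F v - b v" using F(2) v by blast
      then have "3 dvd net F v - b v" by (rule dvd_trans[rotated]) simp
      then have "(of_int (net F v - b v) :: 3) = 0" by (simp only: of_int_3_eq_0_iff)
      then have "(of_int (net F v) :: 3) = of_int (b v)" by simp
      then show ?thesis using n b3[of v] by simp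
    qed
  qed
  ultimately show "\<exists>D. beta_orientation G \<beta> D \<and> extends D D\<^sub>0"
    using orient unfolding beta_orientation_def by blast
qed

text \<open>The zero function has sum zero, and balance modulo 3 at \<open>z\<close> is exactly its
  condition on the pre-orientation.\<close>

lemma M3_extendable_if_Z3_extendable:
  assumes "Z3_extendable_at G z"
  shows "M3_extendable_at G z"
  unfolding M3_extendable_at_def
proof (intro allI impI, elim conjE)
  fix D\<^sub>0 assume pre: "pre_orientation_at G z D\<^sub>0" and c: "[out_degree D\<^sub>0 z = in_degree D\<^sub>0 z] (mod 3)"
  have "3 dvd int (out_degree D\<^sub>0 z) - int (in_degree D\<^sub>0 z)"
  proof -
    have "[int (out_degree D\<^sub>0 z) = int (in_degree D\<^sub>0 z)] (mod int 3)"
      using c by (simp only: cong_int_iff)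
    then show ?thesis by (simp add: cong_iff_dvd_diff)
  qed
  then have "(of_int (int (out_degree D\<^sub>0 z) - int (in_degree D\<^sub>0 z)) :: 3) = 0"
    by (simp only: of_int_3_eq_0_iff)
  then have "net_out_degree D\<^sub>0 z = 0" by (simp add: net_out_degree_def)
  moreover have "zero_sum G (\<lambda>_. 0)" by (simp add: zero_sum_def)
  ultimately show "\<exists>D. mod3_orientation G D \<and> extends D D\<^sub>0"
    using assms pre unfolding Z3_extendable_at_def mod3_orientation_def by blast
qed

theorem theorem1p8:
  shows "(\<forall>(G :: ('v, 'e) pre_multigraph) z.
            multigraph G \<and> k_edge_connected 5 G \<and> essentially_k_edge_connected 23 G \<and>
            z \<in> vertices G \<and> degree G z = 5 \<longrightarrow> M3_extendable_at G z)
       \<and> (\<forall>(G :: ('v, 'e) pre_multigraph) z.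
            multigraph G \<and> k_edge_connected 5 G \<and> essentially_k_edge_connected 23 G \<and>
            z \<in> vertices G \<and> degree G z = 5 \<longrightarrow> Z3_extendable_at G z)"
proof (intro conjI allI impI; elim conjE)
  fix G :: "('v, 'e) pre_multigraph" and z
  assume "multigraph G" "k_edge_connected 5 G" "essentially_k_edge_connected 23 G"
    "z \<in> vertices G" "degree G z = 5"
  then show "Z3_extendable_at G z" by (rule Z3_extendable)
  then show "M3_extendable_at G z" by (rule M3_extendable_if_Z3_extendable)
qed

end
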